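(* Let $G$ be a uniformly Borel amenable Følner graph on a standard Borel space $X$. Then for every $\epsilon>0$ there exists an $\epsilon$-Følner Borel packing $\mathcal{F}$ of $G$ such that for every $G$-invariant Borel probability measure $\mu$ on $X$, $\mu(X\setminus[\mathcal{F}])<\epsilon$.
   Context: A Borel graph on $X$ is a symmetric loopless Borel $G\subseteq X\times X$; $d_G$ is the graph distance and $\mathcal{E}_G$ the connected-component equivalence relation. Uniformly Borel amenable: $G$ has bounded degree and for every $n\ge1$ there is a non-negative Borel $p_n:\mathcal{E}_G\to\mathbb{R}$ with (1) $\sum_{y\,\mathcal{E}_G\,x}p_n(x,y)=1$ for all $x$; (2) if $x\sim_G z$ then $\sum_{y}|p_n(x,y)-p_n(z,y)|<1/n$; (3) there is $r_n>0$ with $p_n(x,y)=0$ whenever $d_G(x,y)>r_n$. For finite $L\subseteq X$, $\partial L$ is the set of $x\in L$ with a neighbour outside $L$; $L$ is $\epsilon$-Følner if $|\partial L|/|L|<\epsilon$. $G$ is Følner if for every $\epsilon>0$ there is $r>0$ such that every ball $B_r(x)$ contains an $\epsilon$-Følner set. Borel packing: a Borel subequivalence relation of the restriction of $\mathcal{E}_G$ to a Borel set $X'\subseteq X$ whose classes (tiles) have uniformly bounded $G$-diameter; $[\mathcal{F}]=X'$. A packing is $\epsilon$-Følner if all tiles are $\epsilon$-Følner. A probability measure $\mu$ on $X$ is $G$-invariant if it is invariant under a Borel action of a finitely generated group (with a symmetric generating set) whose Schreier graph is $G$; equivalently, it is invariant with respect to $\mathcal{E}_G$. *)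

theory Defs
  imports "HOL-Probability.Probability"
begin

text \<open>Graphs on a type are edge relations G :: ('a * 'a) set.  The standard Borel
space X is modelled by a type of class polish_space with its Borel sigma-algebra.\<close>

definition borel_graph :: "('a::topological_space \<times> 'a) set \<Rightarrow> bool" where
  "borel_graph G \<longleftrightarrow> G \<in> sets borel \<and> sym G \<and> (\<forall>x. (x, x) \<notin> G)"

definition comp_rel :: "('a \<times> 'a) set \<Rightarrow> ('a \<times> 'a) set" where
  "comp_rel G = G\<^sup>*"

text \<open>graph distance (meaningful for pairs in the same component)\<close>
definition gdist :: "('a \<times> 'a) set \<Rightarrow> 'a \<Rightarrow> 'a \<Rightarrow> nat" where
  "gdist G x y = (LEAST n. (x, y) \<in> G ^^ n)"

definition bounded_degree :: "('a \<times> 'a) set \<Rightarrow> bool" where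
  "bounded_degree G \<longleftrightarrow> (\<exists>D::nat. \<forall>x. finite {y. (x, y) \<in> G} \<and> card {y. (x, y) \<in> G} \<le> D)"

definition unif_borel_amenable :: "('a::topological_space \<times> 'a) set \<Rightarrow> bool" where
  "unif_borel_amenable G \<longleftrightarrow> bounded_degree G \<and>
    (\<forall>n::nat. n \<ge> 1 \<longrightarrow> (\<exists>p :: 'a \<times> 'a \<Rightarrow> real.
       p \<in> borel_measurable (restrict_space borel (comp_rel G)) \<and>
       (\<forall>x y. (x, y) \<in> comp_rel G \<longrightarrow> p (x, y) \<ge> 0) \<and>
       (\<forall>x. infsum (\<lambda>y. p (x, y)) {y. (x, y) \<in> comp_rel G} = 1) \<and>
       (\<forall>x z. (x, z) \<in> G \<longrightarrow>
          infsum (\<lambda>y. \<bar>p (x, y) - p (z, y)\<bar>) {y. (x, y) \<in> comp_rel G} < 1 / real n) \<and>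
       (\<exists>r::real. r > 0 \<and> (\<forall>x y. (x, y) \<in> comp_rel G \<and> real (gdist G x y) > r \<longrightarrow> p (x, y) = 0))))"

definition boundary :: "('a \<times> 'a) set \<Rightarrow> 'a set \<Rightarrow> 'a set" where
  "boundary G L = {x \<in> L. \<exists>y. (x, y) \<in> G \<and> y \<notin> L}"

definition folner_set :: "('a \<times> 'a) set \<Rightarrow> real \<Rightarrow> 'a set \<Rightarrow> bool" where
  "folner_set G \<epsilon> L \<longleftrightarrow> finite L \<and> L \<noteq> {} \<and> real (card (boundary G L)) / real (card L) < \<epsilon>"

definition gball :: "('a \<times> 'a) set \<Rightarrow> real \<Rightarrow> 'a \<Rightarrow> 'a set" where
  "gball G r x = {y. (x, y) \<in> comp_rel G \<and> real (gdist G x y) \<le> r}"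

definition folner_graph :: "('a \<times> 'a) set \<Rightarrow> bool" where
  "folner_graph G \<longleftrightarrow> (\<forall>\<epsilon>>0. \<exists>r>0. \<forall>x. \<exists>L. L \<subseteq> gball G r x \<and> folner_set G \<epsilon> L)"

text \<open>Borel packing: Borel subequivalence relation F of E_G restricted to the Borel set
  [F] = Domain F, with tiles of uniformly bounded G-diameter.\<close>
definition borel_packing :: "('a::topological_space \<times> 'a) set \<Rightarrow> ('a \<times> 'a) set \<Rightarrow> bool" where
  "borel_packing G F \<longleftrightarrow> Domain F \<in> sets borel \<and> F \<in> sets borel \<and>
     equiv (Domain F) F \<and> F \<subseteq> comp_rel G \<and>
     (\<exists>D::nat. \<forall>x y. (x, y) \<in> F \<longrightarrow> gdist G x y \<le> D)"

definition folner_packing :: "('a::topological_space \<times> 'a) set \<Rightarrow> real \<Rightarrow> ('a \<times> 'a) set \<Rightarrow> bool" where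
  "folner_packing G \<epsilon> F \<longleftrightarrow> borel_packing G F \<and> (\<forall>x \<in> Domain F. folner_set G \<epsilon> (F `` {x}))"

text \<open>Invariance with respect to E_G: invariance under every element of the full group,
  i.e. every Borel bijection (with Borel inverse) whose graph lies in E_G.\<close>
definition invariant_measure :: "('a::topological_space \<times> 'a) set \<Rightarrow> 'a measure \<Rightarrow> bool" where
  "invariant_measure G \<mu> \<longleftrightarrow>
     (\<forall>f. bij f \<and> f \<in> borel_measurable borel \<and> inv f \<in> borel_measurable borel \<and>
          (\<forall>x. (x, f x) \<in> comp_rel G) \<longrightarrow>
          (\<forall>A \<in> sets borel. measure \<mu> (f ` A) = measure \<mu> A))"

end

theory Submission
  imports Defs
begin

text \<open>Measure a finite set A by its edge boundary e(A).  Take thresholds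
\<open>\<theta>\<^sub>1 < \<dots> < \<theta>\<^sub>k\<close> with \<open>\<theta>\<^sub>i / \<theta>\<^sub>i\<^sub>+\<^sub>1\<close> tiny.  At stage i add to the packed
set U a maximal Borel disjoint family of tiles A of bounded diameter, disjoint from U,
with \<open>e(A) < \<theta>\<^sub>i |A|\<close>; write U' for the new packed set.  Cut the amenability kernel p down
to x outside U'.  By maximality no subset of the support of \<open>p(\<cdot>,y)\<close> is a good tile, so
decomposing \<open>p(\<cdot>,y)\<close> into level sets bounds its total variation along edges from below
by \<open>\<theta>\<^sub>i\<close> times its mass.  The mass transport principle turns this into
\<open>\<theta>\<^sub>i \<mu>(X - U') \<le> small + e\<^sub>\<mu>(U')\<close>, while \<open>e\<^sub>\<mu>(U') \<le> e\<^sub>\<mu>(U) + \<theta>\<^sub>i \<mu>(U' - U)\<close>.  Since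
\<open>e\<^sub>\<mu>(U)\<close> is of order \<open>\<theta>\<^sub>i\<^sub>-\<^sub>1\<close>, this gives \<open>\<mu>(X - U') \<le> small + \<mu>(X - U) - \<mu>(X - U')\<close>, so each
stage halves the uncovered mass up to a small error, uniformly in \<open>\<mu>\<close>.

Borel measurability rests on the Lusin--Souslin theorem: it makes the edge relation a
countable union of graphs of Borel involutions, through which neighbours, tiles and the
invariance of \<open>\<mu>\<close> are handled.\<close>

section \<open>The Lusin--Souslin theorem\<close>

text \<open>Edges are counted rather than boundary vertices because the edge count adds up over
  level sets (a discrete coarea formula): the lower bound for sets extends to functions. It still
  dominates \<open>card (boundary G A)\<close>. One stage is not enough for the following reason.
  Cutting the kernel at U' creates jumps along the edges between U' and its complement. The tiles
  just added account for up to \<open>\<theta>\<^sub>i \<mu>(U' - U)\<close> of them, the same order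
  as the left side, so only half of the uncovered mass can be claimed. Older tiles would ruin even
  this unless their boundary were negligible against the current threshold. Hence the thresholds
  increase, and they are chosen from the last stage backwards, with the allowed boundary left free
  in the induction. No measure enters the construction of the tiles, only the estimates; therefore
  one packing serves all invariant measures.\<close>

instance prod :: (polish_space, polish_space) polish_space ..

lemma nat_basis:
  obtains V :: "nat \<Rightarrow> 'a::second_countable_topology set"
  where "\<And>n. open (V n)" "\<And>S x. open S \<Longrightarrow> x \<in> S \<Longrightarrow> \<exists>n. x \<in> V n \<and> V n \<subseteq> S"
proof -
  obtain B :: "'a set set" where B: "countable B" "topological_basis B"
    using ex_countable_basis by blast
  have "B \<noteq> {}"
    using topological_basisE[OF B(2), of UNIV undefined] by auto
  then have r: "range (from_nat_into B) = B"
    using B(1) by (simp add: range_from_nat_into)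
  show thesis
  proof (rule that[of "from_nat_into B"])
    show "open (from_nat_into B n)" for n
      using B(2) \<open>B \<noteq> {}\<close> by (meson from_nat_into topological_basis_open)
    show "\<exists>n. x \<in> from_nat_into B n \<and> from_nat_into B n \<subseteq> S" if "open S" "x \<in> S" for S x
      using topological_basisE[OF B(2) that] r by (metis rangeE)
  qed
qed

text \<open>Closed subsets of \<open>Z \<times> \<real>\<^sup>\<nat>\<close> play the role that closed subsets of Baire space
have in the textbook proof; the real coordinates make open sets closed shadows at once.\<close>

definition closed_shadow :: "'z::polish_space set \<Rightarrow> bool" where
  "closed_shadow B \<longleftrightarrow> (\<exists>C::('z \<times> (nat \<Rightarrow> real)) set. closed C \<and> inj_on fst C \<and> fst ` C = B)"

lemma closed_shadow_closed:
  assumes "closed B" shows "closed_shadow B"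
  unfolding closed_shadow_def
proof (intro exI conjI)
  show "closed (B \<times> {\<lambda>_::nat. 0::real})" using assms by (intro closed_Times) auto
qed (auto simp: inj_on_def)

lemma continuous_on_coord [continuous_intros]:
  "continuous_on S g \<Longrightarrow> continuous_on S (\<lambda>x. g x (i::'i) :: 'b::topological_space)"
  by (rule continuous_on_product_then_coordinatewise)

text \<open>The extra coordinate \<open>1 / infdist z (-B)\<close> runs off to infinity at the
  boundary of \<open>B\<close>, which makes the lifted set closed; pinning the other coordinates to
  0 keeps the projection injective. \<open>UNIV\<close> is treated apart because
  \<open>infdist\<close> to the empty set is 0.\<close>

lemma closed_shadow_open:
  assumes "open B" shows "closed_shadow (B :: 'z::polish_space set)"
proof (cases "B = UNIV")
  case True then show ?thesis by (auto intro: closed_shadow_closed)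
next
  case False
  define C where "C = {p :: 'z \<times> (nat \<Rightarrow> real). snd p 0 * infdist (fst p) (-B) = 1 \<and> (\<forall>k. 0 < k \<longrightarrow> snd p k = 0)}"
  have pos: "infdist z (-B) \<noteq> 0 \<longleftrightarrow> z \<in> B" for z
    using in_closed_iff_infdist_zero[of "-B" z] assms False by auto
  have "closed C" unfolding C_def
    by (intro closed_Collect_conj closed_Collect_all closed_Collect_imp closed_Collect_eq continuous_intros) auto
  moreover have "inj_on fst C"
  proof (rule inj_onI)
    fix p q assume pq: "p \<in> C" "q \<in> C" "fst p = fst q"
    have "snd p k = snd q k" for k
    proof (cases "k = 0")
      case True
      have "snd p 0 * infdist (fst p) (-B) = snd q 0 * infdist (fst p) (-B)"
        "infdist (fst p) (-B) \<noteq> 0"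
        using pq by (auto simp: C_def)
      then show ?thesis using True by simp
    qed (use pq in \<open>auto simp: C_def\<close>)
    then show "p = q" using pq(3) by (auto intro: prod_eqI)
  qed
  moreover have "fst ` C = B"
  proof
    show "fst ` C \<subseteq> B"
    proof
      fix z assume "z \<in> fst ` C"
      then have "infdist z (-B) \<noteq> 0" by (auto simp: C_def)
      then show "z \<in> B" using pos by blast
    qed
    show "B \<subseteq> fst ` C"
    proof
      fix z assume "z \<in> B"
      then have "(z, \<lambda>k. if k = 0 then 1 / infdist z (-B) else 0) \<in> C"
        using pos[of z] by (auto simp: C_def)
      then show "z \<in> fst ` C" by force
    qed
  qed
  ultimately show ?thesis unfolding closed_shadow_def by blast
qed

text \<open>A point of the intersection has one witness sequence for every \<open>B n\<close>;
  \<open>prod_encode\<close> interleaves them into a single sequence, which is unique because each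
  of them is.\<close>

lemma closed_shadow_INT:
  assumes "\<And>n::nat. closed_shadow (B n)" shows "closed_shadow (\<Inter>n. B n :: 'z::polish_space set)"
proof -
  obtain C :: "nat \<Rightarrow> ('z \<times> (nat \<Rightarrow> real)) set"
    where C: "\<And>n. closed (C n)" "\<And>n. inj_on fst (C n)" "\<And>n. fst ` C n = B n"
    using assms unfolding closed_shadow_def by metis
  define D where "D = {p. \<forall>n. (fst p, \<lambda>k. snd p (prod_encode (n, k))) \<in> C n}"
  have "closed ((\<lambda>p. (fst p, \<lambda>k. snd p (prod_encode (n, k)))) -` C n)" for n
    by (intro closed_vimage C continuous_intros)
  then have "closed D" unfolding D_def
    by (intro closed_Collect_all) (simp add: vimage_def)
  moreover have "inj_on fst D"
  proof (rule inj_onI)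
    fix p q assume pq: "p \<in> D" "q \<in> D" "fst p = fst q"
    have "(\<lambda>k. snd p (prod_encode (n, k))) = (\<lambda>k. snd q (prod_encode (n, k)))" for n
      using inj_onD[OF C(2)[of n], of "(fst p, \<lambda>k. snd p (prod_encode (n, k)))" "(fst q, \<lambda>k. snd q (prod_encode (n, k)))"]
        pq by (simp add: D_def)
    then have "snd p (prod_encode (n, k)) = snd q (prod_encode (n, k))" for n k
      by meson
    then have "snd p m = snd q m" for m by (metis prod_decode_inverse surj_pair)
    then show "p = q" using pq(3) by (auto intro: prod_eqI)
  qed
  moreover have "fst ` D = (\<Inter>n. B n)"
  proof
    show "fst ` D \<subseteq> (\<Inter>n. B n)" using C(3) by (force simp: D_def)
    show "(\<Inter>n. B n) \<subseteq> fst ` D"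
    proof
      fix z assume z: "z \<in> (\<Inter>n. B n)"
      have "\<exists>t. (z, t) \<in> C n" for n
      proof -
        have "z \<in> fst ` C n" using z C(3) by auto
        then show ?thesis by auto
      qed
      then obtain t where "\<And>n. (z, t n) \<in> C n" by metis
      then have "(z, \<lambda>m. t (fst (prod_decode m)) (snd (prod_decode m))) \<in> D"
        by (simp add: D_def)
      then show "z \<in> fst ` D" by force
    qed
  qed
  ultimately show ?thesis unfolding closed_shadow_def by blast
qed

text \<open>Coordinate 0 records the piece that contains the point. Since integers are discrete,
  this index is eventually constant along a convergent sequence, so the lifted union stays closed;
  disjointness makes the index, hence the lift, unique.\<close>

lemma closed_shadow_disjoint_UN:
  assumes "\<And>n::nat. closed_shadow (B n)" "disjoint_family B"
  shows "closed_shadow (\<Union>n. B n :: 'z::polish_space set)"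
proof -
  obtain C :: "nat \<Rightarrow> ('z \<times> (nat \<Rightarrow> real)) set"
    where C: "\<And>n. closed (C n)" "\<And>n. inj_on fst (C n)" "\<And>n. fst ` C n = B n"
    using assms unfolding closed_shadow_def by metis
  define D where "D = {p. \<exists>n. snd p 0 = real n \<and> (fst p, \<lambda>k. snd p (Suc k)) \<in> C n}"
  have "closed D"
    unfolding closed_sequential_limits
  proof (intro allI impI, elim conjE)
    fix x l assume x: "\<forall>n. x n \<in> D" and l: "x \<longlonglongrightarrow> l"
    have "continuous_on UNIV (\<lambda>p :: 'z \<times> (nat \<Rightarrow> real). snd p 0)" by (intro continuous_intros)
    from continuous_on_tendsto_compose[OF this l] have l0: "(\<lambda>n. snd (x n) 0) \<longlonglongrightarrow> snd l 0"
      by simp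
    have "continuous_on UNIV (\<lambda>p :: 'z \<times> (nat \<Rightarrow> real). (fst p, \<lambda>k. snd p (Suc k)))" by (intro continuous_intros)
    from continuous_on_tendsto_compose[OF this l]
    have l1: "(\<lambda>n. (fst (x n), \<lambda>k. snd (x n) (Suc k))) \<longlonglongrightarrow> (fst l, \<lambda>k. snd l (Suc k))"
      by simp
    obtain m where m: "\<And>n. snd (x n) 0 = real (m n)" "\<And>n. (fst (x n), \<lambda>k. snd (x n) (Suc k)) \<in> C (m n)"
      using x unfolding D_def by simp metis
    have "Cauchy (\<lambda>n. real (m n))" using l0 m(1) by (simp add: LIMSEQ_imp_Cauchy)
    then obtain M where "\<And>a b. a \<ge> M \<Longrightarrow> b \<ge> M \<Longrightarrow> dist (real (m a)) (real (m b)) < 1"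
      unfolding Cauchy_def by (meson zero_less_one)
    then have mM: "m a = m M" if "a \<ge> M" for a
      using that[THEN \<open>\<And>a b. a \<ge> M \<Longrightarrow> b \<ge> M \<Longrightarrow> dist (real (m a)) (real (m b)) < 1\<close>, of M]
      unfolding dist_real_def by linarith
    have ev: "\<forall>\<^sub>F a in sequentially. m a = m M" unfolding eventually_sequentially using mM by blast
    have "(\<lambda>n. snd (x n) 0) \<longlonglongrightarrow> real (m M)"
      by (rule tendsto_eventually) (use ev m(1) in \<open>auto elim: eventually_mono\<close>)
    then have "snd l 0 = real (m M)" using l0 LIMSEQ_unique by blast
    moreover have "(fst l, \<lambda>k. snd l (Suc k)) \<in> C (m M)"
      by (rule Lim_in_closed_set[OF C(1) _ _ l1])
        (use ev m(2) in \<open>auto elim!: eventually_mono, metis\<close>)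
    ultimately show "l \<in> D" by (auto simp: D_def)
  qed
  moreover have "inj_on fst D"
  proof (rule inj_onI)
    fix p q assume pq: "p \<in> D" "q \<in> D" "fst p = fst q"
    obtain n m where nm: "snd p 0 = real n" "(fst p, \<lambda>k. snd p (Suc k)) \<in> C n"
      "snd q 0 = real m" "(fst q, \<lambda>k. snd q (Suc k)) \<in> C m"
      using pq by (auto simp: D_def)
    have "fst p \<in> B n" using imageI[OF nm(2), of fst] C(3) by simp
    moreover have "fst p \<in> B m" using imageI[OF nm(4), of fst] C(3) pq(3) by simp
    ultimately have "n = m" using assms(2) by (auto simp: disjoint_family_on_def)
    then have "(\<lambda>k. snd p (Suc k)) = (\<lambda>k. snd q (Suc k))"
      using inj_onD[OF C(2)[of n] _ nm(2), of "(fst q, \<lambda>k. snd q (Suc k))"] nm(4) pq(3) by simp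
    then have "snd p (Suc k) = snd q (Suc k)" for k by meson
    then have "snd p k = snd q k" for k using nm \<open>n = m\<close> by (cases k) auto
    then show "p = q" using pq(3) by (auto intro: prod_eqI)
  qed
  moreover have "fst ` D = (\<Union>n. B n)"
  proof
    show "fst ` D \<subseteq> (\<Union>n. B n)" using C(3) by (force simp: D_def)
    show "(\<Union>n. B n) \<subseteq> fst ` D"
    proof
      fix z assume "z \<in> (\<Union>n. B n)"
      then obtain n t where "(z, t) \<in> C n" using C(3) by fastforce
      then have "(z, case_nat (real n) t) \<in> D"
        by (auto simp: D_def intro!: exI[of _ n])
      then show "z \<in> fst ` D" by force
    qed
  qed
  ultimately show ?thesis unfolding closed_shadow_def by blast
qed

text \<open>Complements are carried along in the induction because only disjoint unions are
  available: a countable union is first made disjoint, and each piece is \<open>a n\<close>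
  intersected with complements of earlier sets.\<close>

lemma closed_shadow_borel:
  assumes "B \<in> sets (borel :: 'z::polish_space measure)"
  shows "closed_shadow B"
proof -
  have "B \<in> sigma_sets UNIV {S :: 'z set. open S}" using assms by (simp add: borel_def)
  then have "closed_shadow B \<and> closed_shadow (-B)"
  proof induction
    case (Basic a) then show ?case by (auto intro: closed_shadow_closed closed_shadow_open)
  next
    case Empty then show ?case by (auto intro: closed_shadow_closed)
  next
    case (Compl a) then show ?case by (simp add: Compl_eq_Diff_UNIV[symmetric])
  next
    case (Union a)
    have fin: "closed_shadow (- (\<Union>i<n. a i))" for n
    proof (cases "n = 0")
      case False
      \<comment> \<open>Repeating the last set turns the finite intersection into a sequence, to
        which \<open>closed_shadow_INT\<close> applies.\<close>
      have "- (\<Union>i<n. a i) = (\<Inter>i. - a (min i (n - 1)))"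
      proof -
        have "x \<in> a (min i (n - 1)) \<Longrightarrow> \<exists>j<n. x \<in> a j" for x i
          using False by (intro exI[of _ "min i (n - 1)"]) auto
        moreover have "\<exists>i. x \<in> a (min i (n - 1))" if "x \<in> a j" "j < n" for x j
        proof -
          have "min j (n - 1) = j" using that(2) by linarith
          then show ?thesis using that(1) by metis
        qed
        ultimately show ?thesis by blast
      qed
      then show ?thesis using Union closed_shadow_INT[of "\<lambda>i. - a (min i (n - 1))"] by auto
    qed (auto intro: closed_shadow_closed)
    have "closed_shadow (disjointed a n)" for n
    proof -
      have "disjointed a n = (\<Inter>i::nat. if i = 0 then a n else - (\<Union>i<n. a i))"
        by (auto simp: disjointed_def atLeast0LessThan split: if_splits)
      then show ?thesis using closed_shadow_INT[of "\<lambda>i::nat. if i = 0 then a n else - (\<Union>i<n. a i)"] fin Union by auto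
    qed
    then have "closed_shadow (\<Union>n. disjointed a n)"
      by (intro closed_shadow_disjoint_UN) (auto intro: disjoint_family_disjointed)
    moreover have "closed_shadow (- (\<Union>i. a i))"
      using closed_shadow_INT[of "\<lambda>i. - a i"] Union by simp
    ultimately show ?case by (simp add: UN_disjointed_eq)
  qed
  then show ?thesis by simp
qed

section \<open>Separation of disjoint images by Borel sets\<close>

definition borel_sep :: "'x::topological_space set \<Rightarrow> 'x set \<Rightarrow> bool" where
  "borel_sep A B \<longleftrightarrow> (\<exists>S\<in>sets borel. A \<subseteq> S \<and> S \<inter> B = {})"

text \<open>Used in contrapositive form: if two countable unions cannot be separated, then some pair
  of their pieces cannot be separated either.\<close>

lemma borel_sep_UN:
  assumes "\<And>n m::nat. borel_sep (A n) (B m)"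
  shows "borel_sep (\<Union>n::nat. A n) (\<Union>m. B m)"
proof -
  have "\<forall>n m. \<exists>S. S \<in> sets borel \<and> A n \<subseteq> S \<and> S \<inter> B m = {}"
    using assms by (simp add: borel_sep_def Bex_def)
  then obtain S where "\<forall>n m. S n m \<in> sets borel \<and> A n \<subseteq> S n m \<and> S n m \<inter> B m = {}"
    unfolding choice_iff by (elim exE)
  then have S: "S n m \<in> sets borel" "A n \<subseteq> S n m" "S n m \<inter> B m = {}" for n m
    by simp_all
  have "(\<Union>n. \<Inter>m. S n m) \<in> sets borel" using S(1) by (intro sets.countable_UN' sets.countable_INT') auto
  moreover have "(\<Union>n. A n) \<subseteq> (\<Union>n. \<Inter>m. S n m)"
    using S(2) by (intro UN_mono INT_greatest) auto
  moreover have "(\<Union>n. \<Inter>m. S n m) \<inter> (\<Union>m. B m) = {}"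
    using S(3) by (force simp: disjoint_iff)
  ultimately show ?thesis by (simp add: borel_sep_def Bex_def) (intro exI conjI)
qed

lemma closed_small_cover:
  fixes P :: "'a::polish_space set"
  assumes "closed P" "e > 0"
  obtains K :: "nat \<Rightarrow> 'a set" where "\<And>n. closed (K n)" "P = (\<Union>n. K n)"
    "\<And>n x y. x \<in> K n \<Longrightarrow> y \<in> K n \<Longrightarrow> dist x y \<le> e"
proof -
  obtain D :: "'a set" where D: "countable D" "\<And>X. open X \<Longrightarrow> X \<noteq> {} \<Longrightarrow> \<exists>d\<in>D. d \<in> X"
    using countable_dense_setE by blast
  have "D \<noteq> {}" using D(2)[of UNIV] by auto
  define K where "K n = P \<inter> cball (from_nat_into D n) (e/2)" for n
  show thesis
  proof (rule that[of K])
    show "closed (K n)" for n using assms by (auto simp: K_def)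
    show "P = (\<Union>n. K n)"
    proof
      show "P \<subseteq> (\<Union>n. K n)"
      proof
        fix x assume "x \<in> P"
        obtain d where "d \<in> D" "d \<in> ball x (e/2)" using D(2)[of "ball x (e/2)"] assms by auto
        moreover obtain n where "d = from_nat_into D n"
          using \<open>d \<in> D\<close> D(1) from_nat_into_surj by metis
        ultimately have "x \<in> K n" using \<open>x \<in> P\<close> by (simp add: K_def dist_commute)
        then show "x \<in> (\<Union>n. K n)" by blast
      qed
    qed (auto simp: K_def)
    show "dist x y \<le> e" if "x \<in> K n" "y \<in> K n" for n x y
      using that dist_triangle3[of x y "from_nat_into D n"] by (auto simp: K_def)
  qed
qed

text \<open>Cantor's intersection theorem. The diameter bound starts at index \<open>Suc n\<close>
  because the set at which the nested construction starts is arbitrary.\<close>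

lemma decreasing_closed_limit:
  fixes P :: "nat \<Rightarrow> 'a::polish_space set"
  assumes cl: "\<And>n. closed (P n)" and dec: "\<And>n. P (Suc n) \<subseteq> P n" and ne: "\<And>n. P n \<noteq> {}"
    and small: "\<And>n x y. x \<in> P (Suc n) \<Longrightarrow> y \<in> P (Suc n) \<Longrightarrow> dist x y \<le> 1 / real (Suc n)"
  obtains p where "\<And>n. p \<in> P n"
proof -
  have "\<forall>n. \<exists>x. x \<in> P n" using ne by blast
  then obtain x where x: "\<And>n. x n \<in> P n" unfolding choice_iff by blast
  have mono: "P m \<subseteq> P n" if "n \<le> m" for n m
    using lift_Suc_antimono_le[of P, OF dec that] by blast
  have "Cauchy x"
  proof (rule metric_CauchyI)
    fix e :: real assume "e > 0"
    then obtain n where n: "1 / real (Suc n) < e" using nat_approx_posE by blast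
    have "dist (x a) (x b) < e" if "a \<ge> Suc n" "b \<ge> Suc n" for a b
      using small[of "x a" n "x b"] mono[OF that(1)] mono[OF that(2)] x n by (meson in_mono le_less_trans)
    then show "\<exists>M. \<forall>m\<ge>M. \<forall>n\<ge>M. dist (x m) (x n) < e" by blast
  qed
  then obtain p where p: "x \<longlonglongrightarrow> p" using Cauchy_convergent convergent_def by blast
  have "p \<in> P n" for n
    by (rule Lim_in_closed_set[OF cl _ _ p])
      (use x mono in \<open>auto simp: eventually_sequentially intro!: exI[of _ n]\<close>)
  then show thesis using that by blast
qed

text \<open>Inseparability passes to some pair of small closed pieces. Iterating shrinks the pieces
  to points \<open>p\<close> and \<open>q\<close>; their images differ, so by continuity disjoint
  neighbourhoods of \<open>f p\<close> and \<open>g q\<close> separate the images of late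
  pieces.\<close>

lemma lusin_separation_closed:
  fixes f :: "'p::polish_space \<Rightarrow> 'x::t2_space" and g :: "'q::polish_space \<Rightarrow> 'x"
  assumes P: "closed P" and Q: "closed Q" and f: "continuous_on P f" and g: "continuous_on Q g"
    and disj: "f ` P \<inter> g ` Q = {}"
  shows "borel_sep (f ` P) (g ` Q)"
proof (rule ccontr)
  assume nsep: "\<not> borel_sep (f ` P) (g ` Q)"
  define Pr where "Pr s \<longleftrightarrow> closed (fst s) \<and> closed (snd s) \<and> \<not> borel_sep (f ` fst s) (g ` snd s) \<and> fst s \<subseteq> P \<and> snd s \<subseteq> Q" for s
  define small where "small n s \<longleftrightarrow> (\<forall>x\<in>fst s. \<forall>y\<in>fst s. dist x y \<le> 1 / real (Suc n)) \<and>
      (\<forall>x\<in>snd s. \<forall>y\<in>snd s. dist x y \<le> 1 / real (Suc n))" for n :: nat and s :: "'p set \<times> 'q set"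
  have step: "\<exists>s'. Pr s' \<and> (fst s' \<subseteq> fst s \<and> snd s' \<subseteq> snd s \<and> small n s')" if "Pr s" for s n
  proof -
    have c: "closed (fst s)" "closed (snd s)" using that by (auto simp: Pr_def)
    have e: "0 < 1 / real (Suc n)" by simp
    obtain K :: "nat \<Rightarrow> 'p set" where K: "\<And>n. closed (K n)" "fst s = (\<Union>n. K n)"
      "\<And>i x y. x \<in> K i \<Longrightarrow> y \<in> K i \<Longrightarrow> dist x y \<le> 1 / real (Suc n)"
      by (rule closed_small_cover[OF c(1) e]) blast
    obtain L :: "nat \<Rightarrow> 'q set" where L: "\<And>n. closed (L n)" "snd s = (\<Union>n. L n)"
      "\<And>i x y. x \<in> L i \<Longrightarrow> y \<in> L i \<Longrightarrow> dist x y \<le> 1 / real (Suc n)"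
      by (rule closed_small_cover[OF c(2) e]) blast
    have "\<not> borel_sep (\<Union>i. f ` K i) (\<Union>j. g ` L j)"
      using that K(2) L(2) by (simp add: Pr_def image_UN)
    then obtain i j where "\<not> borel_sep (f ` K i) (g ` L j)"
      using borel_sep_UN[of "\<lambda>i. f ` K i" "\<lambda>j. g ` L j"] by blast
    moreover have "K i \<subseteq> fst s" "L j \<subseteq> snd s" using K(2) L(2) by auto
    moreover from this have "K i \<subseteq> P" "L j \<subseteq> Q" using that by (auto simp: Pr_def)
    ultimately show ?thesis
      using K(1,3) L(1,3) by (intro exI[of _ "(K i, L j)"]) (simp add: Pr_def small_def)
  qed
  have "Pr (P, Q)" using assms nsep by (simp add: Pr_def)
  then obtain s where s: "\<And>n. Pr (s n)"
      "\<And>n. fst (s (Suc n)) \<subseteq> fst (s n) \<and> snd (s (Suc n)) \<subseteq> snd (s n) \<and> small n (s (Suc n))"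
    using dependent_nat_choice[of "\<lambda>_. Pr" "\<lambda>n s s'. fst s' \<subseteq> fst s \<and> snd s' \<subseteq> snd s \<and> small n s'"] step
    by blast
  \<comment> \<open>An empty image is separated from anything, so inseparability keeps both sides
    inhabited.\<close>
  have ne: "fst (s n) \<noteq> {}" "snd (s n) \<noteq> {}" for n
    using s(1)[of n] unfolding Pr_def borel_sep_def by force+
  obtain p where p: "\<And>n. p \<in> fst (s n)"
    by (rule decreasing_closed_limit[of "\<lambda>n. fst (s n)"])
      (use s ne in \<open>auto simp: Pr_def small_def\<close>)
  obtain q where q: "\<And>n. q \<in> snd (s n)"
    by (rule decreasing_closed_limit[of "\<lambda>n. snd (s n)"])
      (use s ne in \<open>auto simp: Pr_def small_def\<close>)
  have "p \<in> P" "q \<in> Q" using p q s(1)[of 0] by (auto simp: Pr_def)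
  then have "f p \<noteq> g q" using disj by blast
  then obtain U W where UW: "open U" "open W" "f p \<in> U" "g q \<in> W" "U \<inter> W = {}"
    using hausdorff by metis
  obtain d where d: "d > 0" "\<And>x. x \<in> P \<Longrightarrow> dist x p < d \<Longrightarrow> f x \<in> U"
    using f \<open>p \<in> P\<close> UW(1,3) unfolding continuous_on_def tendsto_def eventually_at
    by (metis UW(3))
  obtain d' where d': "d' > 0" "\<And>x. x \<in> Q \<Longrightarrow> dist x q < d' \<Longrightarrow> g x \<in> W"
    using g \<open>q \<in> Q\<close> UW(2,4) unfolding continuous_on_def tendsto_def eventually_at
    by (metis UW(4))
  obtain n where n: "1 / real (Suc n) < min d d'" using nat_approx_posE d(1) d'(1) by (metis min_less_iff_conj)
  have "dist x p < d" if "x \<in> fst (s (Suc n))" for x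
    using s(2)[of n] that p[of "Suc n"] n unfolding small_def by fastforce
  moreover have "dist x q < d'" if "x \<in> snd (s (Suc n))" for x
    using s(2)[of n] that q[of "Suc n"] n unfolding small_def by fastforce
  ultimately have "f ` fst (s (Suc n)) \<subseteq> U" "g ` snd (s (Suc n)) \<subseteq> W"
    using d(2) d'(2) s(1)[of "Suc n"] unfolding Pr_def by blast+
  then have "borel_sep (f ` fst (s (Suc n))) (g ` snd (s (Suc n)))"
    using UW unfolding borel_sep_def by (intro bexI[of _ U]) auto
  then show False using s(1)[of "Suc n"] by (simp add: Pr_def)
qed

text \<open>A Borel set is the projection of a closed set in a larger Polish space, and
  \<open>fst\<close> is continuous; so the closed case applies to \<open>f \<circ> fst\<close> and
  \<open>g \<circ> fst\<close>.\<close>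

lemma lusin_separation:
  fixes f :: "'p::polish_space \<Rightarrow> 'x::t2_space" and g :: "'q::polish_space \<Rightarrow> 'x"
  assumes P: "P \<in> sets borel" and Q: "Q \<in> sets borel" and f: "continuous_on P f" and g: "continuous_on Q g"
    and disj: "f ` P \<inter> g ` Q = {}"
  shows "borel_sep (f ` P) (g ` Q)"
proof -
  obtain C :: "('p \<times> (nat \<Rightarrow> real)) set" where C: "closed C" "fst ` C = P"
    using closed_shadow_borel[OF P] unfolding closed_shadow_def by blast
  obtain D :: "('q \<times> (nat \<Rightarrow> real)) set" where D: "closed D" "fst ` D = Q"
    using closed_shadow_borel[OF Q] unfolding closed_shadow_def by blast
  have "borel_sep ((f \<circ> fst) ` C) ((g \<circ> fst) ` D)"
    by (intro lusin_separation_closed C D continuous_on_compose continuous_on_fst continuous_on_id)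
      (use f g C D disj in \<open>auto simp: image_comp[symmetric]\<close>)
  then show ?thesis using C(2) D(2) by (metis image_comp)
qed

text \<open>Injectivity lets \<open>f(C \<inter> V n)\<close> and \<open>f(C - V n)\<close> be separated by a Borel set \<open>S n\<close>.  A point y
lies in \<open>f(C)\<close> iff the basic open sets V n with \<open>y \<in> S n\<close> shrink to a point of C: this is the
Borel condition E below.\<close>

lemma lusin_souslin_closed:
  fixes f :: "'p::polish_space \<Rightarrow> 'x::polish_space"
  assumes C: "closed C" and f: "continuous_on C f" and inj: "inj_on f C"
  shows "f ` C \<in> sets borel"
proof -
  obtain V :: "nat \<Rightarrow> 'p set" where V: "\<And>n. open (V n)"
    "\<And>S x. open S \<Longrightarrow> x \<in> S \<Longrightarrow> \<exists>n. x \<in> V n \<and> V n \<subseteq> S"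
    using nat_basis by blast
  have "\<exists>S. S \<in> sets borel \<and> f ` (C \<inter> V n) \<subseteq> S \<and> S \<inter> f ` (C - V n) = {}" for n
  proof -
    have "borel_sep (f ` (C \<inter> V n)) (f ` (C - V n))"
    proof (rule lusin_separation)
      show "f ` (C \<inter> V n) \<inter> f ` (C - V n) = {}" using inj by (auto simp: inj_on_def)
    qed (use C V(1)[of n] f in \<open>auto intro: continuous_on_subset\<close>)
    then show ?thesis by (auto simp: borel_sep_def)
  qed
  then obtain S where S: "\<And>n. S n \<in> sets borel" "\<And>n. f ` (C \<inter> V n) \<subseteq> S n" "\<And>n. S n \<inter> f ` (C - V n) = {}"
    by metis
  define small where "small m n \<longleftrightarrow> (\<forall>x\<in>V n. \<forall>y\<in>V n. dist x y \<le> 1 / real (Suc m))" for m n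
  \<comment> \<open>The second intersection runs over finite lists, hence is countable. It makes the
    sets \<open>V n\<close> with \<open>y \<in> S n\<close> compatible: any finitely many of them
    meet inside \<open>C\<close>, at points whose images come arbitrarily close to
    \<open>y\<close>.\<close>
  define E where "E = (\<Inter>m. \<Union>n\<in>{n. small m n}. S n) \<inter>
    (\<Inter>l::nat list. - (\<Inter>n\<in>set l. S n) \<union> closure (f ` (C \<inter> (\<Inter>n\<in>set l. V n))))"
  have fin: "(\<Inter>n\<in>set l. S n) \<in> sets borel" for l :: "nat list"
    using S(1) by (cases "l = []") (auto intro!: sets.finite_INT)
  have "E \<in> sets borel" unfolding E_def
    by (intro sets.Int sets.countable_INT' sets.countable_UN' sets.Un borel_comp fin borel_closed closed_closure S)
       (auto intro!: sets.countable_UN' S sets.Un borel_comp fin)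
  moreover have "f ` C = E"
  proof (intro equalityI subsetI)
    fix y assume "y \<in> f ` C"
    then obtain z where z: "z \<in> C" "y = f z" by blast
    have iff: "y \<in> S n \<longleftrightarrow> z \<in> V n" for n using z S(2,3)[of n] by blast
    have sm: "\<exists>n. small m n \<and> y \<in> S n" for m
    proof -
      define r where "r = 1 / real (Suc m)"
      have "r > 0" by (simp add: r_def)
      then obtain n where "z \<in> V n" "V n \<subseteq> ball z (r / 2)"
        using V(2)[of "ball z (r / 2)" z] by auto
      moreover then have "small m n" unfolding small_def r_def[symmetric]
      proof (intro ballI)
        fix x y assume "x \<in> V n" "y \<in> V n"
        then have "dist z x < r / 2" "dist z y < r / 2"
          using subsetD[OF \<open>V n \<subseteq> ball z (r / 2)\<close>] by simp_all
        then show "dist x y \<le> r" using dist_triangle3[of x y z] by linarith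
      qed
      ultimately show ?thesis using iff by blast
    qed
    have "y \<in> closure (f ` (C \<inter> (\<Inter>n\<in>set l. V n)))" if "y \<in> (\<Inter>n\<in>set l. S n)" for l
    proof -
      have "z \<in> C \<inter> (\<Inter>n\<in>set l. V n)" using that z(1) by (simp add: iff)
      then have "y \<in> f ` (C \<inter> (\<Inter>n\<in>set l. V n))" unfolding z(2) by (rule imageI)
      then show ?thesis by (rule subsetD[OF closure_subset])
    qed
    with sm show "y \<in> E" unfolding E_def by blast
  next
    fix y assume y: "y \<in> E"
    then have "\<exists>n. small m n \<and> y \<in> S n" for m by (auto simp: E_def)
    then obtain k where k: "\<And>m. small m (k m)" "\<And>m. y \<in> S (k m)" by metis
    \<comment> \<open>Choosing \<open>z m\<close> in the first \<open>m\<close> of the shrinking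
      sets makes \<open>z\<close> Cauchy while \<open>f (z m)\<close> tends to \<open>y\<close>;
      closedness of \<open>C\<close> then supplies the preimage.\<close>
    define P where "P m = C \<inter> (\<Inter>i<m. V (k i))" for m
    have cl: "y \<in> closure (f ` P m)" for m
    proof -
      have "y \<in> (\<Inter>n\<in>set (map k [0..<m]). S n)" using k by auto
      then have "y \<in> closure (f ` (C \<inter> (\<Inter>n\<in>set (map k [0..<m]). V n)))"
        using y unfolding E_def by blast
      moreover have "(\<Inter>n\<in>set (map k [0..<m]). V n) = (\<Inter>i<m. V (k i))" by (auto simp: lessThan_atLeast0)
      ultimately show ?thesis by (simp add: P_def)
    qed
    have "\<exists>z. z \<in> P m \<and> dist (f z) y < 1 / real (Suc m)" for m
    proof -
      have "\<exists>y'\<in>f ` P m. dist y' y < 1 / real (Suc m)"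
        using cl[of m, unfolded closure_approachable, rule_format, of "1 / real (Suc m)"] by simp
      then show ?thesis by blast
    qed
    then obtain z where z: "\<And>m. z m \<in> P m" "\<And>m. dist (f (z m)) y < 1 / real (Suc m)" by metis
    have zV: "z m \<in> V (k i)" if "i < m" for i m using z(1)[of m] that by (auto simp: P_def)
    have "Cauchy z"
    proof (rule metric_CauchyI)
      fix e :: real assume "e > 0"
      then obtain n where n: "1 / real (Suc n) < e" using nat_approx_posE by blast
      have "dist (z a) (z b) < e" if "a \<ge> Suc n" "b \<ge> Suc n" for a b
        using k(1)[of n] zV[of n a] zV[of n b] that n unfolding small_def by force
      then show "\<exists>M. \<forall>m\<ge>M. \<forall>n\<ge>M. dist (z m) (z n) < e" by blast
    qed
    then obtain p where p: "z \<longlonglongrightarrow> p" using Cauchy_convergent convergent_def by blast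
    have zC: "z m \<in> C" for m using z(1) by (auto simp: P_def)
    then have "p \<in> C" using C p closed_sequentially by blast
    have "(\<lambda>m. f (z m)) \<longlonglongrightarrow> f p"
      using f p zC \<open>p \<in> C\<close> unfolding continuous_on_sequentially by (auto simp: comp_def)
    moreover have "(\<lambda>m. f (z m)) \<longlonglongrightarrow> y"
    proof (rule metric_LIMSEQ_I)
      fix e :: real assume "e > 0"
      then obtain n where n: "1 / real (Suc n) < e" using nat_approx_posE by blast
      have "dist (f (z m)) y < e" if "m \<ge> n" for m
      proof -
        have "1 / real (Suc m) \<le> 1 / real (Suc n)" using that by (simp add: field_simps)
        then show ?thesis using z(2)[of m] n by linarith
      qed
      then show "\<exists>no. \<forall>n\<ge>no. dist (f (z n)) y < e" by blast
    qed
    ultimately have "y = f p" using LIMSEQ_unique by blast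
    then show "y \<in> f ` C" using \<open>p \<in> C\<close> by blast
  qed
  ultimately show ?thesis by simp
qed

text \<open>The closed shadow of \<open>B\<close> projects injectively, so
  \<open>f \<circ> fst\<close> is injective and continuous on a closed set and has the same
  image.\<close>

theorem lusin_souslin:
  fixes f :: "'p::polish_space \<Rightarrow> 'x::polish_space"
  assumes B: "B \<in> sets borel" and f: "continuous_on B f" and inj: "inj_on f B"
  shows "f ` B \<in> sets borel"
proof -
  obtain C :: "('p \<times> (nat \<Rightarrow> real)) set" where C: "closed C" "inj_on fst C" "fst ` C = B"
    using closed_shadow_borel[OF B] unfolding closed_shadow_def by blast
  have "(f \<circ> fst) ` C \<in> sets borel"
    by (intro lusin_souslin_closed C continuous_on_compose continuous_on_fst continuous_on_id comp_inj_on)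
      (use f inj C in auto)
  then show ?thesis using C(3) by (metis image_comp)
qed

section \<open>Borel graphs of bounded degree and group actions\<close>

text \<open>Balls of at most half the distance to the nearest other point are disjoint. The indices
  \<open>l\<close> will serve as a countable label for an enumeration of a finite section.\<close>

lemma finite_disjoint_basis:
  fixes h :: "nat \<Rightarrow> 'b::metric_space"
  assumes V: "\<And>S x. open S \<Longrightarrow> x \<in> S \<Longrightarrow> \<exists>n. x \<in> V n \<and> V n \<subseteq> S"
    and inj: "inj_on h {..d}"
  obtains l where "\<And>i. i \<le> d \<Longrightarrow> h i \<in> V (l i)" "\<And>i j. i \<le> d \<Longrightarrow> j \<le> d \<Longrightarrow> i \<noteq> j \<Longrightarrow> V (l i) \<inter> V (l j) = {}"
proof -
  have "\<exists>r>0. \<forall>x\<in>h ` {..d}. x \<noteq> h i \<longrightarrow> r \<le> dist (h i) x" for i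
    by (rule finite_set_avoid) simp
  then have "\<forall>i. \<exists>r>0. \<forall>x\<in>h ` {..d}. x \<noteq> h i \<longrightarrow> r \<le> dist (h i) x" by blast
  then obtain r where r: "r i > 0" "\<forall>x\<in>h ` {..d}. x \<noteq> h i \<longrightarrow> r i \<le> dist (h i) x" for i
    by metis
  have "\<exists>n. h i \<in> V n \<and> V n \<subseteq> ball (h i) (r i / 2)" for i
    by (rule V) (use r in auto)
  then obtain l where l: "h i \<in> V (l i)" "V (l i) \<subseteq> ball (h i) (r i / 2)" for i
    by metis
  show thesis
  proof (rule that[of l])
    fix i j assume ij: "i \<le> d" "j \<le> d" "i \<noteq> j"
    then have ne: "h i \<noteq> h j" using inj by (auto simp: inj_on_def)
    have "r i \<le> dist (h i) (h j)" "r j \<le> dist (h i) (h j)"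
      using bspec[OF r(2)[of i], of "h j"] bspec[OF r(2)[of j], of "h i"] ij ne by (simp_all add: dist_commute)
    show "V (l i) \<inter> V (l j) = {}"
    proof (rule ccontr)
      assume "V (l i) \<inter> V (l j) \<noteq> {}"
      then obtain z where "z \<in> V (l i)" "z \<in> V (l j)" by blast
      then have "dist (h i) z < r i / 2" "dist (h j) z < r j / 2" using l(2)[of i] l(2)[of j] by auto
      then show False using dist_triangle2[of "h i" "h j" z] \<open>r i \<le> _\<close> \<open>r j \<le> _\<close> by linarith
    qed
  qed (rule l)
qed

text \<open>Where the section has the maximal number of points, it is enumerated by a unique tuple
once its points are separated by basic open sets; so that part of the domain is an
injective projection, and induction applies to the rest.\<close>

lemma borel_finite_sections:
  fixes B :: "('a::polish_space \<times> 'b::polish_space) set"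
  assumes "B \<in> sets borel" "\<And>x. finite (B `` {x}) \<and> card (B `` {x}) \<le> d"
  shows "\<exists>\<C>. countable \<C> \<and> (\<forall>C\<in>\<C>. C \<in> sets borel \<and> single_valued C) \<and> B = \<Union>\<C>"
  using assms
proof (induction d arbitrary: B)
  case 0
  have "(x, y) \<notin> B" for x y
  proof -
    have "B `` {x} = {}" using "0"(2)[of x] card_0_eq[of "B `` {x}"] by simp
    then show ?thesis by (metis Image_singleton_iff empty_iff)
  qed
  then have "B = {}" by auto
  then show ?case by (intro exI[of _ "{}"]) auto
next
  case (Suc d)
  obtain V :: "nat \<Rightarrow> 'b set" where V: "\<And>n. open (V n)"
    "\<And>S x. open S \<Longrightarrow> x \<in> S \<Longrightarrow> \<exists>n. x \<in> V n \<and> V n \<subseteq> S"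
    using nat_basis by blast
  define dl where "dl l \<longleftrightarrow> (\<forall>i\<le>d. \<forall>j\<le>d. i \<noteq> j \<longrightarrow> V (l ! i) \<inter> V (l ! j) = {})" for l
  \<comment> \<open>The indices up to \<open>d\<close> give \<open>Suc d\<close> disjoint slots, as
    many as a section can have points; a tuple with its i-th point in the i-th slot exhausts the
    section, and in only one order.\<close>
  define tup where "tup l x s \<longleftrightarrow> (\<forall>i\<le>d. (x, s i) \<in> B \<and> s i \<in> V (l ! i))" for l x s
  have enum: "s ` {..d} = B `` {x}" if "dl l" "tup l x s" for l x s
  proof -
    have "inj_on s {..d}"
    proof (rule inj_onI)
      fix i j assume ij: "i \<in> {..d}" "j \<in> {..d}" "s i = s j"
      then have "s i \<in> V (l ! i) \<inter> V (l ! j)" using that(2) by (auto simp: tup_def)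
      then show "i = j" using that(1) ij unfolding dl_def by (metis atMost_iff empty_iff)
    qed
    then have "card (s ` {..d}) = Suc d" by (simp add: card_image)
    then show ?thesis
      using Suc.prems(2)[of x] that(2) by (intro card_seteq) (auto simp: tup_def)
  qed
  have uniq: "y = s i" if t: "dl l" "tup l x s" "(x, y) \<in> B" "y \<in> V (l ! i)" "i \<le> d" for l x s y i
  proof -
    obtain j where j: "j \<le> d" "y = s j" using enum[OF t(1,2)] t(3) by auto
    then have "y \<in> V (l ! i) \<inter> V (l ! j)" using t by (auto simp: tup_def)
    then have "i = j" using t(1,5) j(1) unfolding dl_def by blast
    then show ?thesis using j by simp
  qed
  \<comment> \<open>Sequences are infinite, so the coordinates beyond \<open>d\<close> are tied to
    coordinate 0; otherwise the sequence over a point would not be unique.\<close>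
  define Q where "Q l = {p :: 'a \<times> (nat \<Rightarrow> 'b). tup l (fst p) (snd p) \<and> (\<forall>i>d. snd p i = snd p 0)}" for l
  have Q: "Q l \<in> sets borel" for l
  proof -
    have *: "(\<lambda>p :: 'a \<times> (nat \<Rightarrow> 'b). (fst p, snd p i)) \<in> borel_measurable borel" 
      "(\<lambda>p :: 'a \<times> (nat \<Rightarrow> 'b). snd p i) \<in> borel_measurable borel" for i
      by (intro borel_measurable_continuous_onI continuous_intros)+
    have 1: "(\<Inter>i\<in>{..d}. (\<lambda>p :: 'a \<times> (nat \<Rightarrow> 'b). (fst p, snd p i)) -` B \<inter> (\<lambda>p. snd p i) -` V (l ! i)) \<in> sets borel"
      using measurable_sets[OF *(1) Suc.prems(1)] measurable_sets[OF *(2) borel_open[OF V(1)]]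
      by (intro sets.finite_INT sets.Int) auto
    have 2: "closed {p :: 'a \<times> (nat \<Rightarrow> 'b). \<forall>i>d. snd p i = snd p 0}"
      by (intro closed_Collect_all closed_Collect_imp closed_Collect_eq continuous_intros) auto
    have 3: "Q l = (\<Inter>i\<in>{..d}. (\<lambda>p. (fst p, snd p i)) -` B \<inter> (\<lambda>p. snd p i) -` V (l ! i)) \<inter> {p. \<forall>i>d. snd p i = snd p 0}"
      by (auto simp: Q_def tup_def)
    show ?thesis unfolding 3 using 1 borel_closed[OF 2] by (rule sets.Int)
  qed
  define P where "P l = fst ` Q l" for l
  have P: "P l \<in> sets borel" if "dl l" for l
    unfolding P_def
  proof (rule lusin_souslin[OF Q continuous_on_fst[OF continuous_on_id]], rule inj_onI)
    fix p q assume pq: "p \<in> Q l" "q \<in> Q l" "fst p = fst q"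
    have le: "snd p i = snd q i" if "i \<le> d" for i
    proof (rule uniq[OF \<open>dl l\<close>])
      have "tup l (fst p) (snd p)" using pq(1) by (simp add: Q_def)
      then show "(fst p, snd p i) \<in> B" "snd p i \<in> V (l ! i)" using that by (simp_all add: tup_def)
      show "tup l (fst p) (snd q)" using pq(2,3) by (simp add: Q_def)
    qed (rule that)
    have "snd p i = snd q i" for i
    proof (cases "i \<le> d")
      case False
      then have "snd p i = snd p 0" "snd q i = snd q 0" using pq(1,2) by (simp_all add: Q_def)
      then show ?thesis using le[of 0] by simp
    qed (rule le)
    then show "p = q" using pq(3) by (auto intro: prod_eqI)
  qed
  have Pex: "\<exists>l. dl l \<and> x \<in> P l" if card: "card (B `` {x}) = Suc d" for x
  proof -
    have "finite (B `` {x})" using Suc.prems(2) by blast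
    then obtain h where h: "bij_betw h {0..<Suc d} (B `` {x})"
      using ex_bij_betw_nat_finite card by metis
    have eq: "{0..<Suc d} = {..d}" by auto
    obtain l where l: "\<And>i. i \<le> d \<Longrightarrow> h i \<in> V (l i)"
      "\<And>i j. i \<le> d \<Longrightarrow> j \<le> d \<Longrightarrow> i \<noteq> j \<Longrightarrow> V (l i) \<inter> V (l j) = {}"
      using finite_disjoint_basis[OF V(2), of h d] h unfolding bij_betw_def eq by blast
    define L where "L = map l [0..<Suc d]"
    have L: "L ! i = l i" if "i \<le> d" for i using that by (simp add: L_def del: upt_Suc)
    have hB: "(x, h i) \<in> B" if "i \<le> d" for i using h that unfolding bij_betw_def eq by auto
    have "dl L" using l(2) L by (simp add: dl_def)
    moreover have "(x, \<lambda>i. if i \<le> d then h i else h 0) \<in> Q L"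
      using l(1) L hB by (auto simp: Q_def tup_def)
    ultimately show ?thesis unfolding P_def by force
  qed
  define X where "X = (\<Union>l\<in>Collect dl. P l)"
  have X: "X \<in> sets borel" unfolding X_def
    by (rule sets.countable_UN') (use P in auto)
  \<comment> \<open>Off \<open>X\<close> no section has \<open>Suc d\<close> points, so the
    induction hypothesis applies.\<close>
  define B' where "B' = B \<inter> ((-X) \<times> UNIV)"
  have "B' \<in> sets borel" unfolding B'_def using Suc.prems(1) X by (intro sets.Int borel_Times) auto
  moreover have "finite (B' `` {x}) \<and> card (B' `` {x}) \<le> d" for x
  proof (cases "x \<in> X")
    case True
    then have "B' `` {x} = {}" by (auto simp: B'_def)
    then show ?thesis by simp
  next
    case False
    then have "B' `` {x} = B `` {x}" by (auto simp: B'_def)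
    moreover have "card (B `` {x}) \<noteq> Suc d" using False Pex by (auto simp: X_def)
    ultimately show ?thesis using Suc.prems(2)[of x] by simp
  qed
  ultimately obtain \<C> where \<C>: "countable \<C>" "\<forall>C\<in>\<C>. C \<in> sets borel \<and> single_valued C" "B' = \<Union>\<C>"
    using Suc.IH[of B'] by auto
  \<comment> \<open>Over \<open>P l\<close> each slot contains exactly one point of the section,
    hence each slot cuts out the graph of a function.\<close>
  define \<D> where "\<D> = (\<lambda>(l, i). B \<inter> (P l \<times> V (l ! i))) ` (Collect dl \<times> {..d})"
  have "countable \<D>" unfolding \<D>_def by (intro countable_image countable_SIGMA) auto
  moreover have "C \<in> sets borel \<and> single_valued C" if CD: "C \<in> \<D>" for C
  proof -
    obtain l i where li: "dl l" "i \<le> d" "C = B \<inter> (P l \<times> V (l ! i))" using CD by (auto simp: \<D>_def)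
    have "single_valued C"
    proof (rule single_valuedI)
      fix x y z assume "(x, y) \<in> C" "(x, z) \<in> C"
      then obtain s where "tup l x s" using li by (auto simp: P_def Q_def)
      then show "y = z" using uniq[OF li(1), of x s _ i] \<open>(x, y) \<in> C\<close> \<open>(x, z) \<in> C\<close> li by auto
    qed
    then show ?thesis using li P V(1) Suc.prems(1) by (auto intro!: sets.Int borel_Times)
  qed
  moreover have "B = \<Union>(\<C> \<union> \<D>)"
  proof
    show "\<Union>(\<C> \<union> \<D>) \<subseteq> B"
    proof -
      have "\<Union>\<C> \<subseteq> B" using \<C>(3) by (auto simp: B'_def)
      moreover have "\<Union>\<D> \<subseteq> B" by (auto simp: \<D>_def)
      ultimately show ?thesis by auto
    qed
    show "B \<subseteq> \<Union>(\<C> \<union> \<D>)"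
    proof
      fix p assume p: "p \<in> B"
      obtain x y where xy: "p = (x, y)" by (cases p)
      show "p \<in> \<Union>(\<C> \<union> \<D>)"
      proof (cases "x \<in> X")
        case False
        then have "p \<in> B'" using p xy by (simp add: B'_def)
        then show ?thesis using \<C>(3) by auto
      next
        case True
        then obtain l s where l: "dl l" "x \<in> P l" "tup l x s" by (auto simp: X_def P_def Q_def)
        have "y \<in> s ` {..d}" using enum[OF l(1,3)] p xy by simp
        then obtain i where "i \<le> d" "y = s i" by auto
        then have "p \<in> B \<inter> (P l \<times> V (l ! i))" using l p xy by (auto simp: tup_def)
        moreover have "B \<inter> (P l \<times> V (l ! i)) \<in> \<D>" using l(1) \<open>i \<le> d\<close> by (force simp: \<D>_def)
        ultimately show ?thesis by blast
      qed
    qed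
  qed
  ultimately show ?case using \<C>(1,2) by (intro exI[of _ "\<C> \<union> \<D>"]) auto
qed

text \<open>Being the identity off the domain turns a symmetric single-valued relation into an
  involution of the whole space.\<close>

definition rel_fun :: "('a \<times> 'a) set \<Rightarrow> 'a \<Rightarrow> 'a" where
  "rel_fun S x = (if x \<in> Domain S then THE y. (x, y) \<in> S else x)"

lemma rel_fun_eq:
  assumes "single_valued S" "(x, y) \<in> S" shows "rel_fun S x = y"
  using assms by (auto simp: rel_fun_def single_valued_def intro!: the_equality)

lemma rel_fun_involution:
  assumes "single_valued S" "sym S" shows "rel_fun S (rel_fun S x) = x"
proof (cases "x \<in> Domain S")
  case True
  then obtain y where y: "(x, y) \<in> S" by blast
  then have "(y, x) \<in> S" using assms by (auto dest: symD)
  then show ?thesis using y assms by (simp add: rel_fun_eq)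
qed (simp add: rel_fun_def)

text \<open>Apart from points off the domain, a preimage is the projection of the part of
  \<open>S\<close> with second entry in \<open>A\<close>. The projection is injective because
  \<open>S\<close> is single-valued, so Lusin--Souslin makes it Borel.\<close>

lemma measurable_rel_fun:
  fixes S :: "('a::polish_space \<times> 'a) set"
  assumes S: "S \<in> sets borel" "single_valued S" shows "rel_fun S \<in> borel_measurable borel"
proof (rule measurableI)
  fix A :: "'a set" assume A: "A \<in> sets borel"
  have dom: "Domain T \<in> sets borel" if "T \<in> sets borel" "T \<subseteq> S" for T
  proof -
    have "inj_on fst T"
    proof (rule inj_onI)
      fix p q assume "p \<in> T" "q \<in> T" "fst p = fst q"
      have "(fst p, snd p) \<in> S" using \<open>p \<in> T\<close> that(2) by auto
      moreover have "(fst p, snd q) \<in> S" using \<open>q \<in> T\<close> that(2) \<open>fst p = fst q\<close> by auto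
      ultimately have "snd p = snd q" by (rule single_valuedD[OF S(2)])
      then show "p = q" using \<open>fst p = fst q\<close> by (auto intro: prod_eqI)
    qed
    then show ?thesis using lusin_souslin[OF that(1) continuous_on_fst[OF continuous_on_id]]
      by (simp add: Domain_fst)
  qed
  have "rel_fun S -` A \<inter> space borel = Domain (S \<inter> (UNIV \<times> A)) \<union> (A - Domain S)" (is "?L = ?R")
  proof (intro equalityI subsetI)
    fix x assume x: "x \<in> ?L"
    show "x \<in> ?R"
    proof (cases "x \<in> Domain S")
      case True
      then obtain y where y: "(x, y) \<in> S" by blast
      then show ?thesis using x rel_fun_eq[OF S(2) y] by auto
    qed (use x in \<open>auto simp: rel_fun_def\<close>)
  next
    fix x assume x: "x \<in> ?R"
    then show "x \<in> ?L"
    proof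
      assume "x \<in> Domain (S \<inter> (UNIV \<times> A))"
      then obtain y where y: "(x, y) \<in> S" "y \<in> A" by blast
      then show ?thesis using rel_fun_eq[OF S(2) y(1)] by auto
    qed (auto simp: rel_fun_def)
  qed
  moreover have "S \<inter> (UNIV \<times> A) \<in> sets borel" using S(1) A by (intro sets.Int borel_Times) auto
  ultimately show "rel_fun S -` A \<inter> space borel \<in> sets borel" using dom S A by auto
qed simp

lemma borel_converse:
  fixes S :: "('a::second_countable_topology \<times> 'b::second_countable_topology) set"
  assumes "S \<in> sets borel" shows "S\<inverse> \<in> sets borel"
proof -
  have "(\<lambda>p :: 'b \<times> 'a. (snd p, fst p)) \<in> borel_measurable borel"
    by (intro borel_measurable_continuous_onI continuous_intros)
  from measurable_sets[OF this assms] show ?thesis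
    by (rule back_subst[of "\<lambda>T. T \<in> sets borel"]) auto
qed

text \<open>An edge lies in one functional piece in each direction, and its ends have disjoint basic
  neighbourhoods. Intersecting these gives an injective partial map with disjoint domain and range;
  together with its converse it is a partial involution.\<close>

lemma borel_graph_involutions:
  fixes G :: "('a::polish_space \<times> 'a) set"
  assumes G: "borel_graph G" and bd: "bounded_degree G"
  obtains g :: "nat \<Rightarrow> 'a \<Rightarrow> 'a" where
    "\<And>n. g n \<in> borel_measurable borel" "\<And>n x. g n (g n x) = x"
    "\<And>n x. g n x = x \<or> (x, g n x) \<in> G" "\<And>x y. (x, y) \<in> G \<Longrightarrow> \<exists>n. g n x = y"
proof -
  obtain V :: "nat \<Rightarrow> 'a set" where V: "\<And>n. open (V n)"
    "\<And>S x. open S \<Longrightarrow> x \<in> S \<Longrightarrow> \<exists>n. x \<in> V n \<and> V n \<subseteq> S"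
    using nat_basis by blast
  obtain D where "\<And>x. finite {y. (x, y) \<in> G} \<and> card {y. (x, y) \<in> G} \<le> D"
    using bd unfolding bounded_degree_def by blast
  moreover have "{y. (x, y) \<in> G} = G `` {x}" for x by auto
  moreover have GB: "G \<in> sets borel" "sym G" "\<And>x. (x, x) \<notin> G" using G by (auto simp: borel_graph_def)
  ultimately obtain \<C> where \<C>: "countable \<C>" "\<forall>C\<in>\<C>. C \<in> sets borel \<and> single_valued C" "G = \<Union>\<C>"
    using borel_finite_sections[of G D] by auto
  define H where "H = (\<lambda>(C, C', m, n). C \<inter> C'\<inverse> \<inter> (V m \<times> V n))"
  define I where "I = \<C> \<times> \<C> \<times> {(m, n). V m \<inter> V n = {}}"
  \<comment> \<open>The empty relation, acting as the identity, keeps the family inhabited, so that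
    it can be enumerated even for a graph without edges.\<close>
  define \<S> where "\<S> = insert {} ((\<lambda>i. H i \<union> (H i)\<inverse>) ` I)"
  have "countable \<S>" unfolding \<S>_def I_def
    by (intro countable_insert countable_image countable_SIGMA \<C>(1)) auto
  have "\<S> \<noteq> {}" by (simp add: \<S>_def)
  have \<S>: "S \<in> sets borel \<and> sym S \<and> single_valued S \<and> S \<subseteq> G" if S: "S \<in> \<S>" for S
  proof (cases "S = {}")
    case False
    then obtain C C' m n where C: "C \<in> \<C>" "C' \<in> \<C>" "V m \<inter> V n = {}" "S = H (C, C', m, n) \<union> (H (C, C', m, n))\<inverse>"
      using S by (auto simp: \<S>_def I_def)
    have sv: "single_valued C" "single_valued C'" "C \<in> sets borel" "C' \<in> sets borel" using \<C> C by auto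
    have Hb: "H (C, C', m, n) \<in> sets borel"
      unfolding H_def using sv V(1) by (auto intro!: sets.Int borel_converse borel_Times)
    have "single_valued S"
      unfolding C(4) single_valued_def
    proof (intro allI impI)
      fix x y z assume "(x, y) \<in> H (C, C', m, n) \<union> (H (C, C', m, n))\<inverse>" "(x, z) \<in> H (C, C', m, n) \<union> (H (C, C', m, n))\<inverse>"
      then show "y = z" using sv(1,2) C(3) by (auto simp: H_def single_valued_def)
    qed
    moreover have "S \<subseteq> G"
    proof -
      have "H (C, C', m, n) \<subseteq> G" using C(1) \<C>(3) by (auto simp: H_def)
      moreover have "G\<inverse> = G" using GB(2) by (simp add: sym_conv_converse_eq)
      ultimately show ?thesis unfolding C(4) by (metis Un_least converse_mono)
    qed
    moreover have "sym S" unfolding C(4) by (simp add: sym_Un_converse)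
    ultimately show ?thesis using Hb borel_converse[OF Hb] by (simp add: C(4))
  qed (simp add: sym_def)
  define g where "g n = rel_fun (from_nat_into \<S> n)" for n
  have fn: "from_nat_into \<S> n \<in> \<S>" for n by (rule from_nat_into[OF \<open>\<S> \<noteq> {}\<close>])
  show thesis
  proof (rule that[of g])
    fix n x
    show "g n \<in> borel_measurable borel" using \<S>[OF fn[of n]] by (auto simp: g_def intro: measurable_rel_fun)
    show "g n (g n x) = x" using \<S>[OF fn[of n]] by (auto simp: g_def intro: rel_fun_involution)
    show "g n x = x \<or> (x, g n x) \<in> G"
    proof (cases "x \<in> Domain (from_nat_into \<S> n)")
      case True
      then obtain y where "(x, y) \<in> from_nat_into \<S> n" by blast
      then show ?thesis using \<S>[OF fn[of n]] rel_fun_eq[of "from_nat_into \<S> n" x y] by (auto simp: g_def)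
    qed (simp add: g_def rel_fun_def)
  next
    fix x y assume xy: "(x, y) \<in> G"
    then have "(y, x) \<in> G" using GB(2) by (auto dest: symD)
    then obtain C C' where C: "C \<in> \<C>" "(x, y) \<in> C" "C' \<in> \<C>" "(y, x) \<in> C'" using xy \<C>(3) by auto
    have "x \<noteq> y" using xy GB(3) by auto
    then obtain U W where UW: "open U" "open W" "x \<in> U" "y \<in> W" "U \<inter> W = {}"
      using hausdorff by metis
    obtain m n where mn: "x \<in> V m" "V m \<subseteq> U" "y \<in> V n" "V n \<subseteq> W"
      using V(2)[OF UW(1,3)] V(2)[OF UW(2,4)] by blast
    then have "V m \<inter> V n = {}" using UW(5) by blast
    then have "(C, C', m, n) \<in> I" using C by (simp add: I_def)
    then have "H (C, C', m, n) \<union> (H (C, C', m, n))\<inverse> \<in> \<S>" unfolding \<S>_def by blast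
    then obtain k where k: "from_nat_into \<S> k = H (C, C', m, n) \<union> (H (C, C', m, n))\<inverse>"
      using from_nat_into_surj[OF \<open>countable \<S>\<close>] by blast
    have "(x, y) \<in> from_nat_into \<S> k" using C mn by (auto simp: k H_def)
    then have "g k x = y" using \<S>[OF fn[of k]] by (auto simp: g_def intro: rel_fun_eq)
    then show "\<exists>n. g n x = y" by blast
  qed
qed

section \<open>The countable group generated by the involutions\<close>

primrec word_act :: "(nat \<Rightarrow> 'a \<Rightarrow> 'a) \<Rightarrow> nat list \<Rightarrow> 'a \<Rightarrow> 'a" where
  "word_act g [] x = x"
| "word_act g (n # w) x = g n (word_act g w x)"

lemma word_act_append: "word_act g (v @ w) x = word_act g v (word_act g w x)"
  by (induction v) auto

lemma word_act_rev:
  assumes "\<And>n x. g n (g n x) = x" shows "word_act g (rev w) (word_act g w x) = x"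
  using assms by (induction w arbitrary: x) (auto simp: word_act_append)

lemma measurable_word_act:
  assumes "\<And>n. g n \<in> borel_measurable borel"
  shows "word_act g w \<in> borel_measurable (borel :: 'a::topological_space measure)"
proof (induction w)
  case (Cons n w)
  have "(\<lambda>x. g n (word_act g w x)) \<in> borel_measurable borel"
    using measurable_compose[OF Cons assms[of n]] .
  then show ?case by (simp add: fun_eq_iff[symmetric] cong: measurable_cong)
qed (simp add: measurable_ident_sets cong: measurable_cong)

text \<open>Words in the involutions are countably many, reversing a word inverts it, and the orbits
  are the connected components. The list \<open>\<gamma>\<close> may name the same map
  repeatedly.\<close>

lemma feldman_moore:
  fixes G :: "('a::polish_space \<times> 'a) set"
  assumes G: "borel_graph G" and bd: "bounded_degree G"
  obtains \<gamma> :: "nat \<Rightarrow> 'a \<Rightarrow> 'a" where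
    "\<And>k. \<gamma> k \<in> borel_measurable borel" "\<And>k. inv (\<gamma> k) \<in> borel_measurable borel" "\<And>k. bij (\<gamma> k)"
    "\<And>x y. (x, y) \<in> comp_rel G \<longleftrightarrow> (\<exists>k. \<gamma> k x = y)"
proof -
  obtain g :: "nat \<Rightarrow> 'a \<Rightarrow> 'a" where g:
    "\<And>n. g n \<in> borel_measurable borel" "\<And>n x. g n (g n x) = x"
    "\<And>n x. g n x = x \<or> (x, g n x) \<in> G" "\<And>x y. (x, y) \<in> G \<Longrightarrow> \<exists>n. g n x = y"
    using borel_graph_involutions[OF G bd] by blast
  have rev: "word_act g (rev w) (word_act g w x) = x" "word_act g w (word_act g (rev w) x) = x" for w x
    using word_act_rev[of g w x] word_act_rev[of g "rev w" x] g(2) by auto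
  have inv: "inv (word_act g w) = word_act g (rev w)" for w
    by (rule inv_equality) (use rev in auto)
  have bij: "bij (word_act g w)" for w
    by (rule o_bij[of "word_act g (rev w)"]) (use rev in auto)
  have orb: "(x, y) \<in> comp_rel G \<longleftrightarrow> (\<exists>w. word_act g w x = y)" for x y
  proof
    assume "(x, y) \<in> comp_rel G"
    then have "(x, y) \<in> G\<^sup>*" by (simp add: comp_rel_def)
    then show "\<exists>w. word_act g w x = y"
    proof induction
      case base then show ?case by (intro exI[of _ "[]"]) simp
    next
      case (step y z)
      then obtain w n where "word_act g w x = y" "g n y = z" using g(4) by blast
      then show ?case by (intro exI[of _ "n # w"]) simp
    qed
  next
    have "(x, word_act g w x) \<in> G\<^sup>*" for w
    proof (induction w)
      case (Cons n w)
      then show ?case using g(3)[of n "word_act g w x"] by (auto intro: rtrancl_into_rtrancl)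
    qed simp
    then show "\<exists>w. word_act g w x = y \<Longrightarrow> (x, y) \<in> comp_rel G" by (auto simp: comp_rel_def)
  qed
  show thesis
  proof (rule that[of "\<lambda>k. word_act g (from_nat k)"])
    show "(x, y) \<in> comp_rel G \<longleftrightarrow> (\<exists>k. word_act g (from_nat k) x = y)" for x y
      unfolding orb by (metis from_nat_to_nat)
  qed (use g(1) inv bij in \<open>auto intro: measurable_word_act\<close>)
qed

section \<open>Mass transport\<close>

lemma pred_eq_borel:
  fixes f g :: "'c \<Rightarrow> 'a::{second_countable_topology, t2_space}"
  assumes "f \<in> borel_measurable M" "g \<in> borel_measurable M"
  shows "Measurable.pred M (\<lambda>x. f x = g x)"
proof -
  have "closed {p :: 'a \<times> 'a. fst p = snd p}"
    by (intro closed_Collect_eq continuous_intros)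
  from measurable_sets[OF borel_measurable_Pair[OF assms] borel_closed[OF this]]
  show ?thesis by (simp add: pred_def vimage_def Int_def conj_commute)
qed

text \<open>A sum is taken as an integral over counting measure: values in \<open>ennreal\<close>
  need no summability, and the rules for \<open>nn_integral\<close> apply although the index type
  may be uncountable.\<close>

abbreviation csum :: "('b \<Rightarrow> ennreal) \<Rightarrow> ennreal" where
  "csum \<phi> \<equiv> (\<integral>\<^sup>+y. \<phi> y \<partial>count_space UNIV)"

lemma csum_reindex:
  fixes f :: "nat \<Rightarrow> 'b"
  assumes inj: "inj_on f K" and sup: "\<And>y. \<phi> y \<noteq> 0 \<Longrightarrow> y \<in> f ` K"
  shows "csum \<phi> = (\<Sum>k. \<phi> (f k) * indicator K k)"
proof -
  have "csum \<phi> = (\<integral>\<^sup>+y. \<phi> y * indicator (f ` K) y \<partial>count_space UNIV)"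
    using sup by (intro nn_integral_cong) (auto simp: indicator_def)
  also have "\<dots> = (\<integral>\<^sup>+y. \<phi> y \<partial>count_space (f ` K))"
    by (subst nn_integral_count_space_indicator) auto
  also have "\<dots> = (\<integral>\<^sup>+k. \<phi> (f k) \<partial>count_space K)"
    by (rule nn_integral_bij_count_space[symmetric]) (use inj in \<open>simp add: bij_betw_def\<close>)
  also have "\<dots> = (\<integral>\<^sup>+k. \<phi> (f k) * indicator K k \<partial>count_space UNIV)"
    by (subst nn_integral_count_space_indicator) auto
  finally show ?thesis by (simp add: nn_integral_count_space_nat)
qed

lemma csum_indicator: "finite {y. P y} \<Longrightarrow> csum (\<lambda>y. of_bool (P y)) = of_nat (card {y. P y})"
proof -
  assume f: "finite {y. P y}"
  have "csum (\<lambda>y. of_bool (P y)) = (\<Sum>y\<in>{y. P y}. of_bool (P y))"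
    by (rule nn_integral_count_space') (use f in auto)
  then show ?thesis by simp
qed

locale borel_orbits =
  fixes G :: "('a::polish_space \<times> 'a) set" and \<gamma> :: "nat \<Rightarrow> 'a \<Rightarrow> 'a"
  assumes G_borel: "G \<in> sets borel" and G_sym: "sym G"
    and G_fin: "\<And>x. finite {y. (x, y) \<in> G}"
    and \<gamma>_meas [measurable]: "\<And>k. \<gamma> k \<in> borel_measurable borel"
    and inv_meas [measurable]: "\<And>k. inv (\<gamma> k) \<in> borel_measurable borel"
    and \<gamma>_bij: "\<And>k. bij (\<gamma> k)"
    and orbit: "\<And>x y. (x, y) \<in> comp_rel G \<longleftrightarrow> (\<exists>k. \<gamma> k x = y)"
begin

lemma \<gamma>_inv [simp]: "inv (\<gamma> k) (\<gamma> k x) = x" "\<gamma> k (inv (\<gamma> k) x) = x"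
  using \<gamma>_bij[of k] by (simp_all add: bij_is_inj bij_is_surj surj_f_inv_f)

lemma G_meas [measurable]: "G \<in> sets (borel \<Otimes>\<^sub>M borel)"
  using G_borel borel_prod by metis

lemma comp_rel_meas [measurable]: "comp_rel G \<in> sets (borel \<Otimes>\<^sub>M borel)"
proof -
  have "Measurable.pred (borel \<Otimes>\<^sub>M borel) (\<lambda>p. \<gamma> k (fst p) = snd p)" for k
    by (rule pred_eq_borel) measurable
  then have "Measurable.pred (borel \<Otimes>\<^sub>M borel) (\<lambda>p. \<exists>k. \<gamma> k (fst p) = snd p)"
    by (rule pred_intros_countable)
  moreover have "comp_rel G = {p. \<exists>k. \<gamma> k (fst p) = snd p}" using orbit by auto
  ultimately show ?thesis by (simp add: pred_def space_pair_measure)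
qed

text \<open>Different indices may send \<open>x\<close> to the same point; keeping the least one
  enumerates the class of \<open>x\<close> without repetition and measurably in
  \<open>x\<close>.\<close>

definition first :: "nat \<Rightarrow> 'a \<Rightarrow> bool" where
  "first k x \<longleftrightarrow> (\<forall>j<k. \<gamma> j x \<noteq> \<gamma> k x)"

lemma first_meas [measurable]: "Measurable.pred borel (first k)"
proof -
  have [measurable]: "Measurable.pred borel (\<lambda>x. \<gamma> j x = \<gamma> k x)" for j
    by (rule pred_eq_borel) measurable
  show ?thesis unfolding first_def by measurable
qed

lemma inj_first: "inj_on (\<lambda>k. \<gamma> k x) {k. first k x}"
  by (rule inj_onI) (metis first_def linorder_neqE_nat mem_Collect_eq)

lemma first_ex:
  assumes "(x, y) \<in> comp_rel G" obtains k where "first k x" "\<gamma> k x = y"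
proof -
  have ex: "\<exists>k. \<gamma> k x = y" using assms orbit by blast
  have "\<gamma> (LEAST k. \<gamma> k x = y) x = y" by (rule LeastI_ex[OF ex])
  moreover have "first (LEAST k. \<gamma> k x = y) x"
    unfolding first_def using \<open>\<gamma> (LEAST k. \<gamma> k x = y) x = y\<close> not_less_Least by auto
  ultimately show thesis using that by blast
qed

lemma comp_rel_sym: "(x, y) \<in> comp_rel G \<Longrightarrow> (y, x) \<in> comp_rel G"
  using G_sym unfolding comp_rel_def by (meson symD sym_rtrancl)

lemma csum_orbit:
  assumes "\<And>y. \<phi> y \<noteq> 0 \<Longrightarrow> (x, y) \<in> comp_rel G"
  shows "csum \<phi> = (\<Sum>k. \<phi> (\<gamma> k x) * indicator {k. first k x} k)"
proof (rule csum_reindex[OF inj_first])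
  fix y assume "\<phi> y \<noteq> 0"
  then obtain k where "first k x" "\<gamma> k x = y" using assms first_ex by blast
  then show "y \<in> (\<lambda>k. \<gamma> k x) ` {k. first k x}" by auto
qed

text \<open>The class is enumerated backwards from \<open>y\<close>, but leastness of the index is
  tested at the source \<open>inv (\<gamma> k) y\<close>. So the k-th term is the one of
  \<open>csum_orbit\<close> after the substitution \<open>y = \<gamma> k x\<close>.\<close>

lemma csum_orbit':
  assumes "\<And>x. \<phi> x \<noteq> 0 \<Longrightarrow> (x, y) \<in> comp_rel G"
  shows "csum \<phi> = (\<Sum>k. \<phi> (inv (\<gamma> k) y) * indicator {k. first k (inv (\<gamma> k) y)} k)"
proof (rule csum_reindex)
  show "inj_on (\<lambda>k. inv (\<gamma> k) y) {k. first k (inv (\<gamma> k) y)}"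
  proof (rule inj_onI)
    fix k l assume kl: "k \<in> {k. first k (inv (\<gamma> k) y)}" "l \<in> {k. first k (inv (\<gamma> k) y)}" "inv (\<gamma> k) y = inv (\<gamma> l) y"
    have "\<gamma> k (inv (\<gamma> k) y) = \<gamma> l (inv (\<gamma> k) y)" using kl(3) by (metis \<gamma>_inv(2))
    then show "k = l" using inj_first[of "inv (\<gamma> k) y"] kl by (auto simp: inj_on_def)
  qed
next
  fix x assume "\<phi> x \<noteq> 0"
  then obtain k where "first k x" "\<gamma> k x = y" using assms first_ex by blast
  then show "x \<in> (\<lambda>k. inv (\<gamma> k) y) ` {k. first k (inv (\<gamma> k) y)}" by (auto intro!: image_eqI[of _ _ k])
qed

text \<open>The point \<open>h w\<close> names the class in which the sum takes place, so the sum
  becomes a countable series along \<open>\<gamma> k (h w)\<close>. With \<open>h\<close> free, the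
  parameter \<open>w\<close> may be a point or a pair.\<close>

lemma csum_meas:
  assumes h [measurable]: "h \<in> borel_measurable M"
    and \<phi>: "(\<lambda>p. \<phi> (fst p) (snd p)) \<in> borel_measurable (M \<Otimes>\<^sub>M borel)"
    and sup: "\<And>w y. \<phi> w y \<noteq> 0 \<Longrightarrow> (h w, y) \<in> comp_rel G"
  shows "(\<lambda>w. csum (\<phi> w)) \<in> borel_measurable M"
proof -
  have "(\<lambda>w. (\<lambda>p. \<phi> (fst p) (snd p)) (w, \<gamma> k (h w))) \<in> borel_measurable M" for k
    by (rule measurable_compose[OF _ \<phi>]) measurable
  then have 1 [measurable]: "(\<lambda>w. \<phi> w (\<gamma> k (h w))) \<in> borel_measurable M" for k by simp
  have "csum (\<phi> w) = (\<Sum>k. \<phi> w (\<gamma> k (h w)) * (if first k (h w) then 1 else 0))" for w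
    by (subst csum_orbit[of _ "h w"]) (auto simp: sup indicator_def of_bool_def intro!: suminf_cong)
  then show ?thesis by simp
qed

text \<open>Invariance speaks about images; applied to the inverse of \<open>\<gamma> k\<close> it
  yields preimages, which is what \<open>distr\<close> measures.\<close>

lemma distr_invariant:
  assumes "prob_space \<mu>" "sets \<mu> = sets borel" "invariant_measure G \<mu>"
  shows "distr \<mu> borel (\<gamma> k) = \<mu>"
proof (rule measure_eqI)
  interpret prob_space \<mu> by fact
  have [measurable_cong]: "sets \<mu> = sets borel" by fact
  have sp: "space \<mu> = UNIV" using assms(2) by (metis sets_eq_imp_space_eq space_borel)
  show "sets (distr \<mu> borel (\<gamma> k)) = sets \<mu>" using assms(2) by simp
  fix A assume "A \<in> sets (distr \<mu> borel (\<gamma> k))"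
  then have A: "A \<in> sets borel" by simp
  have "measure \<mu> (inv (\<gamma> k) ` A) = measure \<mu> A"
  proof -
    have "(x, inv (\<gamma> k) x) \<in> comp_rel G" for x
      by (rule comp_rel_sym) (use orbit \<gamma>_inv(2) in blast)
    then have "bij (inv (\<gamma> k)) \<and> inv (\<gamma> k) \<in> borel_measurable borel \<and> inv (inv (\<gamma> k)) \<in> borel_measurable borel \<and>
      (\<forall>x. (x, inv (\<gamma> k) x) \<in> comp_rel G)"
      using \<gamma>_bij[of k] by (simp add: inv_inv_eq bij_imp_bij_inv)
    then show ?thesis using assms(3) A unfolding invariant_measure_def by blast
  qed
  moreover have "inv (\<gamma> k) ` A = \<gamma> k -` A"
    using bij_vimage_eq_inv_image[OF \<gamma>_bij[of k], of A] by simp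
  ultimately show "emeasure (distr \<mu> borel (\<gamma> k)) A = emeasure \<mu> A"
    using A by (simp add: emeasure_distr sp emeasure_eq_measure)
qed

text \<open>Along the enumeration the k-th term sends mass from \<open>x\<close> to
  \<open>\<gamma> k x\<close>; since \<open>\<gamma> k\<close> preserves the measure, each term has
  the same integral when read at its target.\<close>

lemma mass_transport:
  assumes \<mu>: "prob_space \<mu>" "sets \<mu> = sets borel" "invariant_measure G \<mu>"
    and \<phi>: "(\<lambda>p. \<phi> (fst p) (snd p)) \<in> borel_measurable (borel \<Otimes>\<^sub>M borel)"
    and sup: "\<And>x y. \<phi> x y \<noteq> 0 \<Longrightarrow> (x, y) \<in> comp_rel G"
  shows "(\<integral>\<^sup>+x. csum (\<lambda>y. \<phi> x y) \<partial>\<mu>) = (\<integral>\<^sup>+y. csum (\<lambda>x. \<phi> x y) \<partial>\<mu>)"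
proof -
  have [measurable_cong]: "sets \<mu> = sets borel" by fact
  have "(\<lambda>w. (\<lambda>p. \<phi> (fst p) (snd p)) (w, \<gamma> k w)) \<in> borel_measurable borel" for k
    by (rule measurable_compose[OF _ \<phi>]) measurable
  then have 1 [measurable]: "(\<lambda>w. \<phi> w (\<gamma> k w)) \<in> borel_measurable borel" for k by simp
  have "(\<lambda>w. (\<lambda>p. \<phi> (fst p) (snd p)) (inv (\<gamma> k) w, w)) \<in> borel_measurable borel" for k
    by (rule measurable_compose[OF _ \<phi>]) measurable
  then have 2 [measurable]: "(\<lambda>w. \<phi> (inv (\<gamma> k) w) w) \<in> borel_measurable borel" for k by simp
  have "(\<integral>\<^sup>+x. csum (\<lambda>y. \<phi> x y) \<partial>\<mu>) = (\<integral>\<^sup>+x. (\<Sum>k. \<phi> x (\<gamma> k x) * (if first k x then 1 else 0)) \<partial>\<mu>)"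
    by (intro nn_integral_cong, subst csum_orbit) (auto simp: sup indicator_def of_bool_def intro!: suminf_cong)
  also have "\<dots> = (\<Sum>k. \<integral>\<^sup>+x. \<phi> x (\<gamma> k x) * (if first k x then 1 else 0) \<partial>\<mu>)"
    by (rule nn_integral_suminf) measurable
  also have "\<dots> = (\<Sum>k. \<integral>\<^sup>+y. \<phi> (inv (\<gamma> k) y) y * (if first k (inv (\<gamma> k) y) then 1 else 0) \<partial>\<mu>)"
  proof (rule suminf_cong)
    fix k
    have "(\<integral>\<^sup>+y. \<phi> (inv (\<gamma> k) y) y * (if first k (inv (\<gamma> k) y) then 1 else 0) \<partial>\<mu>)
      = (\<integral>\<^sup>+y. \<phi> (inv (\<gamma> k) y) y * (if first k (inv (\<gamma> k) y) then 1 else 0) \<partial>distr \<mu> borel (\<gamma> k))"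
      by (simp add: distr_invariant[OF \<mu>])
    also have "\<dots> = (\<integral>\<^sup>+x. \<phi> x (\<gamma> k x) * (if first k x then 1 else 0) \<partial>\<mu>)"
      by (subst nn_integral_distr) auto
    finally show "(\<integral>\<^sup>+x. \<phi> x (\<gamma> k x) * (if first k x then 1 else 0) \<partial>\<mu>)
      = (\<integral>\<^sup>+y. \<phi> (inv (\<gamma> k) y) y * (if first k (inv (\<gamma> k) y) then 1 else 0) \<partial>\<mu>)" by simp
  qed
  also have "\<dots> = (\<integral>\<^sup>+y. (\<Sum>k. \<phi> (inv (\<gamma> k) y) y * (if first k (inv (\<gamma> k) y) then 1 else 0)) \<partial>\<mu>)"
    by (rule nn_integral_suminf[symmetric]) measurable
  also have "\<dots> = (\<integral>\<^sup>+y. csum (\<lambda>x. \<phi> x y) \<partial>\<mu>)"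
    by (intro nn_integral_cong, subst csum_orbit') (auto simp: sup indicator_def of_bool_def intro!: suminf_cong)
  finally show ?thesis .
qed

section \<open>Balls, edge boundaries and tiles given by index lists\<close>

definition ball_rel :: "nat \<Rightarrow> ('a \<times> 'a) set" where
  "ball_rel R = (\<Union>m\<le>R. G ^^ m)"

lemma relpow_meas [measurable]: "G ^^ m \<in> sets (borel \<Otimes>\<^sub>M borel)"
proof (induction m)
  case 0
  have "Measurable.pred (borel \<Otimes>\<^sub>M borel) (\<lambda>p :: 'a \<times> 'a. fst p = snd p)"
    by (rule pred_eq_borel) measurable
  moreover have "(Id :: ('a \<times> 'a) set) = {p. fst p = snd p}" by auto
  ultimately show ?case by (simp add: pred_def space_pair_measure)
next
  case (Suc m)
  note [measurable] = Suc
  \<comment> \<open>The last intermediate vertex is sought among the countably many points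
    \<open>\<gamma> k x\<close>, which keeps the condition Borel.\<close>
  have "(x, y) \<in> G ^^ Suc m \<longleftrightarrow> (\<exists>k. (x, \<gamma> k x) \<in> G ^^ m \<and> (\<gamma> k x, y) \<in> G)" for x y
  proof
    assume "(x, y) \<in> G ^^ Suc m"
    then obtain z where z: "(x, z) \<in> G ^^ m" "(z, y) \<in> G" by auto
    then obtain k where "\<gamma> k x = z"
      using orbit[of x z] relpow_imp_rtrancl[OF z(1)] unfolding comp_rel_def by blast
    then show "\<exists>k. (x, \<gamma> k x) \<in> G ^^ m \<and> (\<gamma> k x, y) \<in> G" using z by blast
  qed auto
  then have "G ^^ Suc m = {p \<in> space (borel \<Otimes>\<^sub>M borel). \<exists>k. (fst p, \<gamma> k (fst p)) \<in> G ^^ m \<and> (\<gamma> k (fst p), snd p) \<in> G}"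
    by (auto simp: space_pair_measure simp del: relpow.simps)
  also have "\<dots> \<in> sets (borel \<Otimes>\<^sub>M borel)" by measurable
  finally show ?case .
qed

lemma ball_rel_meas [measurable]: "ball_rel R \<in> sets (borel \<Otimes>\<^sub>M borel)"
  unfolding ball_rel_def by (rule sets.finite_UN) auto

lemma ball_rel_comp_rel: "ball_rel R \<subseteq> comp_rel G"
  unfolding ball_rel_def comp_rel_def using relpow_imp_rtrancl by blast

lemma ball_rel_mono: "R \<le> S \<Longrightarrow> ball_rel R \<subseteq> ball_rel S"
  unfolding ball_rel_def by (intro UN_mono) auto

lemma finite_ball_rel: "finite {y. (x, y) \<in> ball_rel R}"
proof -
  have "finite {y. (x, y) \<in> G ^^ m}" for m
  proof (induction m)
    case (Suc m)
    have "{y. (x, y) \<in> G ^^ Suc m} = (\<Union>z\<in>{z. (x, z) \<in> G ^^ m}. {y. (z, y) \<in> G})" by auto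
    then show ?case using Suc G_fin by simp
  qed simp
  moreover have "{y. (x, y) \<in> ball_rel R} = (\<Union>m\<le>R. {y. (x, y) \<in> G ^^ m})" by (auto simp: ball_rel_def)
  ultimately show ?thesis by simp
qed

lemma relpow_sym: "(x, y) \<in> G ^^ m \<Longrightarrow> (y, x) \<in> G ^^ m"
proof (induction m arbitrary: y)
  case (Suc m)
  then obtain z where "(x, z) \<in> G ^^ m" "(z, y) \<in> G" by auto
  then show ?case using Suc.IH G_sym by (meson relpow_Suc_I2 symD)
qed auto

lemma ball_rel_sym: "(x, y) \<in> ball_rel R \<Longrightarrow> (y, x) \<in> ball_rel R"
  unfolding ball_rel_def using relpow_sym by blast

lemma ball_rel_trans: "(x, y) \<in> ball_rel R \<Longrightarrow> (y, z) \<in> ball_rel S \<Longrightarrow> (x, z) \<in> ball_rel (R + S)"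
proof -
  assume "(x, y) \<in> ball_rel R" "(y, z) \<in> ball_rel S"
  then obtain m n where "m \<le> R" "n \<le> S" "(x, y) \<in> G ^^ m" "(y, z) \<in> G ^^ n" by (auto simp: ball_rel_def)
  then have "(x, z) \<in> G ^^ (m + n)" "m + n \<le> R + S" by (auto simp: relpow_add)
  then show "(x, z) \<in> ball_rel (R + S)" unfolding ball_rel_def by blast
qed

definition edge_boundary :: "'a set \<Rightarrow> nat" where
  "edge_boundary A = (\<Sum>x\<in>A. card {z. (x, z) \<in> G \<and> z \<notin> A})"

definition good :: "real \<Rightarrow> nat \<Rightarrow> 'a set \<Rightarrow> bool" where
  "good \<theta> R A \<longleftrightarrow> finite A \<and> A \<noteq> {} \<and> (\<forall>x\<in>A. \<forall>y\<in>A. (x, y) \<in> ball_rel R) \<and>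
     real (edge_boundary A) < \<theta> * real (card A)"

lemma image_\<gamma>_borel: "T \<in> sets borel \<Longrightarrow> \<gamma> k ` T \<in> sets borel"
proof -
  assume "T \<in> sets borel"
  then have "inv (\<gamma> k) -` T \<in> sets borel" using measurable_sets[OF inv_meas, of T k] by simp
  moreover have "inv (\<gamma> k) -` T = \<gamma> k ` T"
  proof
    show "inv (\<gamma> k) -` T \<subseteq> \<gamma> k ` T" by (metis \<gamma>_inv(2) image_eqI subsetI vimageD)
  qed auto
  ultimately show ?thesis by simp
qed

text \<open>A finite subset of a class is described by a base point and a finite list of indices; so
  there are only countably many shapes, and for each the base points can range over a Borel
  set.\<close>

definition tile :: "nat list \<Rightarrow> 'a \<Rightarrow> 'a set" where
  "tile l x = (\<lambda>k. \<gamma> k x) ` set l"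

lemma real_card_meas:
  assumes "h \<in> borel_measurable M" "{p \<in> space (M \<Otimes>\<^sub>M borel). P (fst p) (snd p)} \<in> sets (M \<Otimes>\<^sub>M borel)"
    and "\<And>w z. P w z \<Longrightarrow> (h w, z) \<in> G"
  shows "(\<lambda>w. real (card {z. P w z})) \<in> borel_measurable M"
proof -
  have fin: "finite {z. P w z}" for w using assms(3) by (intro finite_subset[OF _ G_fin[of "h w"]]) auto
  have "(\<lambda>p. of_bool (P (fst p) (snd p)) :: ennreal) = (\<lambda>p. if P (fst p) (snd p) then 1 else 0)" by auto
  then have "(\<lambda>w. csum (\<lambda>z. of_bool (P w z))) \<in> borel_measurable M"
    by (intro csum_meas[OF assms(1)])
      (use assms(2,3) in \<open>auto simp: comp_rel_def intro!: measurable_If\<close>)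
  then have "(\<lambda>w. enn2real (csum (\<lambda>z. of_bool (P w z)))) \<in> borel_measurable M" by measurable
  then show ?thesis by (simp add: csum_indicator[OF fin])
qed

text \<open>Injectivity fixes the number of points at \<open>card (set l)\<close> and lets the edge
  boundary be summed over the fixed set \<open>set l\<close>; what remains are finitely many Borel
  conditions on \<open>x\<close>.\<close>

lemma good_tile_meas:
  "{x. inj_on (\<lambda>k. \<gamma> k x) (set l) \<and> good \<theta> R (tile l x)} \<in> sets borel"
proof -
  have eq [measurable]: "Measurable.pred borel (\<lambda>x. \<gamma> j x = \<gamma> k x)" for j k
    by (rule pred_eq_borel) measurable
  have [measurable]: "(\<lambda>x. real (card {z. (\<gamma> k x, z) \<in> G \<and> z \<notin> tile l x})) \<in> borel_measurable borel" for k
  proof (rule real_card_meas[OF \<gamma>_meas])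
    have [measurable]: "Measurable.pred (borel \<Otimes>\<^sub>M borel) (\<lambda>p. snd p = \<gamma> j (fst p))" for j
      by (rule pred_eq_borel) measurable
    show "{p \<in> space (borel \<Otimes>\<^sub>M borel). (\<gamma> k (fst p), snd p) \<in> G \<and> snd p \<notin> tile l (fst p)} \<in> sets (borel \<Otimes>\<^sub>M borel)"
      unfolding tile_def image_iff by measurable
  qed auto
  have iff: "inj_on (\<lambda>k. \<gamma> k x) (set l) \<and> good \<theta> R (tile l x) \<longleftrightarrow>
    (\<forall>j\<in>set l. \<forall>k\<in>set l. \<gamma> j x = \<gamma> k x \<longrightarrow> j = k) \<and> set l \<noteq> {} \<and>
    (\<forall>j\<in>set l. \<forall>k\<in>set l. (\<gamma> j x, \<gamma> k x) \<in> ball_rel R) \<and>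
    (\<Sum>k\<in>set l. real (card {z. (\<gamma> k x, z) \<in> G \<and> z \<notin> tile l x})) < \<theta> * real (card (set l))" (is "_ \<longleftrightarrow> ?Q x") for x
  proof (cases "inj_on (\<lambda>k. \<gamma> k x) (set l)")
    case True
    have "card (tile l x) = card (set l)" unfolding tile_def by (rule card_image[OF True])
    moreover have "real (edge_boundary (tile l x)) = (\<Sum>k\<in>set l. real (card {z. (\<gamma> k x, z) \<in> G \<and> z \<notin> tile l x}))"
      unfolding edge_boundary_def of_nat_sum by (subst (2) tile_def, subst sum.reindex[OF True]) simp
    ultimately show ?thesis using True by (auto simp: good_def inj_on_def tile_def)
  qed (auto simp: inj_on_def)
  have "Measurable.pred borel ?Q" by measurable
  then show ?thesis unfolding iff by (simp add: pred_def)
qed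

end

section \<open>Maximal families of tiles\<close>

lemma equiv_disjoint_blocks:
  assumes disj: "pairwise disjnt \<A>" and F: "F = (\<Union>A\<in>\<A>. A \<times> A)"
  shows "Domain F = \<Union>\<A>" "equiv (\<Union>\<A>) F" "\<And>A y. A \<in> \<A> \<Longrightarrow> y \<in> A \<Longrightarrow> F `` {y} = A"
proof -
  have uniq: "A = B" if "A \<in> \<A>" "B \<in> \<A>" "y \<in> A" "y \<in> B" for A B y
    using disj that unfolding pairwise_def disjnt_def by blast
  show dom: "Domain F = \<Union>\<A>" by (auto simp: F)
  show "equiv (\<Union>\<A>) F"
  proof (rule equivI)
    show "F \<subseteq> \<Union>\<A> \<times> \<Union>\<A>" by (auto simp: F)
    show "refl_on (\<Union>\<A>) F" by (auto simp: F refl_on_def)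
    show "sym F" by (auto simp: F sym_def)
    show "trans F"
    proof (rule transI)
      fix x y z assume "(x, y) \<in> F" "(y, z) \<in> F"
      then obtain A B where "A \<in> \<A>" "x \<in> A" "y \<in> A" "B \<in> \<A>" "y \<in> B" "z \<in> B" by (auto simp: F)
      moreover from this have "A = B" using uniq[of A B y] by simp
      ultimately show "(x, z) \<in> F" by (auto simp: F)
    qed
  qed
  show "F `` {y} = A" if A: "A \<in> \<A>" "y \<in> A" for A y
  proof
    show "F `` {y} \<subseteq> A"
    proof
      fix z assume "z \<in> F `` {y}"
      then obtain B where "B \<in> \<A>" "y \<in> B" "z \<in> B" by (auto simp: F)
      then show "z \<in> A" using uniq[of A B y] A by simp
    qed
    show "A \<subseteq> F `` {y}" using A by (auto simp: F)
  qed
qed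

context borel_orbits
begin

text \<open>Every good set is \<open>tile l x\<close> for some \<open>l\<close> and some
  \<open>x \<in> Y l m\<close>. In the turn of \<open>(l, m)\<close> the tiles of that shape are
  pairwise disjoint, so all good ones that avoid the set covered so far can be added at once. A good
  set missed by the final family would have been added in its own turn.\<close>

lemma greedy_packing:
  assumes U0: "U0 \<in> sets borel"
  obtains F where "F \<in> sets borel" "Domain F \<in> sets borel" "equiv (Domain F) F" "Domain F \<inter> U0 = {}"
    "\<And>y. y \<in> Domain F \<Longrightarrow> good \<theta> R (F `` {y})" "\<And>A. good \<theta> R A \<Longrightarrow> A \<inter> (U0 \<union> Domain F) \<noteq> {}"
proof -
  obtain V :: "nat \<Rightarrow> 'a set" where V: "\<And>n. open (V n)"
    "\<And>S x. open S \<Longrightarrow> x \<in> S \<Longrightarrow> \<exists>n. x \<in> V n \<and> V n \<subseteq> S"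
    using nat_basis by blast
  \<comment> \<open>a Borel set on which the tiles with index list l are pairwise disjoint\<close>
  define Y where "Y l m = {x. x \<in> V m \<and> (\<forall>j\<in>set l. \<forall>k\<in>set l. inv (\<gamma> j) (\<gamma> k x) = x \<or> inv (\<gamma> j) (\<gamma> k x) \<notin> V m)}" for l m
  have Y: "Y l m \<in> sets borel" for l m
  proof -
    have [measurable]: "V m \<in> sets borel" using V(1) by simp
    have [measurable]: "Measurable.pred borel (\<lambda>x. inv (\<gamma> j) (\<gamma> k x) = x)" for j k
      by (rule pred_eq_borel) measurable
    have "Measurable.pred borel (\<lambda>x. x \<in> V m \<and> (\<forall>j\<in>set l. \<forall>k\<in>set l. inv (\<gamma> j) (\<gamma> k x) = x \<or> inv (\<gamma> j) (\<gamma> k x) \<notin> V m))"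
      by measurable
    then show ?thesis by (simp add: Y_def pred_def)
  qed
  have Y_sep: "x = x'" if t: "x \<in> Y l m" "x' \<in> Y l m" "tile l x \<inter> tile l x' \<noteq> {}" for x x' l m
  proof -
    obtain j k where jk: "j \<in> set l" "k \<in> set l" "\<gamma> k x = \<gamma> j x'" using t(3) by (auto simp: tile_def)
    then have "inv (\<gamma> j) (\<gamma> k x) = x'" by simp
    moreover have "inv (\<gamma> j) (\<gamma> k x) = x \<or> inv (\<gamma> j) (\<gamma> k x) \<notin> V m" "x' \<in> V m"
      using t(1,2) jk(1,2) unfolding Y_def by blast+
    ultimately show ?thesis by simp
  qed
  have Y_cov: "\<exists>m. x \<in> Y l m" for x l
  proof -
    \<comment> \<open>These are the finitely many other base points whose tile could meet that of
      \<open>x\<close>; a basic set avoiding them isolates \<open>x\<close>.\<close>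
    define B where "B = (\<lambda>(j, k). inv (\<gamma> j) (\<gamma> k x)) ` (set l \<times> set l) - {x}"
    have "finite B" by (simp add: B_def)
    then have "open (- B)" by (simp add: finite_imp_closed open_Compl)
    moreover have "x \<in> - B" by (simp add: B_def)
    ultimately obtain m where "x \<in> V m" "V m \<subseteq> - B" using V(2) by blast
    then have "x \<in> Y l m" by (auto simp: Y_def B_def)
    then show ?thesis by blast
  qed
  \<comment> \<open>every pair (index list, basic open set) gets one turn\<close>
  define L where "L n = fst (from_nat n :: nat list \<times> nat)" for n
  define M where "M n = snd (from_nat n :: nat list \<times> nat)" for n
  define T where "T n W = {x \<in> Y (L n) (M n). (inj_on (\<lambda>k. \<gamma> k x) (set (L n)) \<and> good \<theta> R (tile (L n) x)) \<and> tile (L n) x \<inter> W = {}}" for n W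
  define U where "U = rec_nat U0 (\<lambda>n W. W \<union> \<Union>(tile (L n) ` T n W))"
  define S where "S n = T n (U n)" for n
  have U_0: "U 0 = U0" and U_Suc: "U (Suc n) = U n \<union> \<Union>(tile (L n) ` S n)" for n
    by (simp_all add: U_def S_def)
  have T_borel: "T n W \<in> sets borel" if [measurable]: "W \<in> sets borel" for n W
  proof -
    have "Measurable.pred borel (\<lambda>x. \<forall>k\<in>set (L n). \<gamma> k x \<notin> W)" by measurable
    then have "{x. \<forall>k\<in>set (L n). \<gamma> k x \<notin> W} \<in> sets borel" by (simp add: pred_def)
    moreover have "T n W = Y (L n) (M n) \<inter> {x. inj_on (\<lambda>k. \<gamma> k x) (set (L n)) \<and> good \<theta> R (tile (L n) x)}
      \<inter> {x. \<forall>k\<in>set (L n). \<gamma> k x \<notin> W}"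
      by (auto simp: T_def tile_def)
    ultimately show ?thesis using Y good_tile_meas by simp
  qed
  have tiles_UN: "\<Union>(tile l ` X) = (\<Union>k\<in>set l. \<gamma> k ` X)" for l X by (auto simp: tile_def)
  have U_borel: "U n \<in> sets borel" for n
  proof (induction n)
    case (Suc n)
    then show ?case unfolding U_Suc tiles_UN S_def
      by (intro sets.Un sets.finite_UN image_\<gamma>_borel T_borel) auto
  qed (simp add: U_0 U0)
  have S_borel: "S n \<in> sets borel" for n unfolding S_def by (rule T_borel[OF U_borel])
  have U_mono: "U n \<subseteq> U m" if "n \<le> m" for n m
    using lift_Suc_mono_le[of U, OF _ that] U_Suc by blast
  have S: "x \<in> Y (L n) (M n)" "good \<theta> R (tile (L n) x)" "tile (L n) x \<inter> U n = {}" if "x \<in> S n" for n x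
    using that by (auto simp: S_def T_def)
  have tile_U: "tile (L n) x \<subseteq> U (Suc n)" if "x \<in> S n" for n x
    using that by (auto simp: U_Suc)
  define \<A> where "\<A> = (\<Union>n. tile (L n) ` S n)"
  define F where "F = (\<Union>A\<in>\<A>. A \<times> A)"
  have lt: "tile (L n) x \<inter> tile (L n') x' = {}" if "x \<in> S n" "x' \<in> S n'" "n < n'" for n n' x x'
    using tile_U[OF that(1)] S(3)[OF that(2)] U_mono[of "Suc n" n'] that(3) by (auto simp: Suc_le_eq)
  have "pairwise disjnt \<A>"
  proof (rule pairwiseI)
    fix A B assume "A \<in> \<A>" "B \<in> \<A>" "A \<noteq> B"
    then obtain n x n' x' where n: "x \<in> S n" "A = tile (L n) x" "x' \<in> S n'" "B = tile (L n') x'"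
      by (auto simp: \<A>_def)
    show "disjnt A B"
    proof (cases n n' rule: linorder_cases)
      case less then show ?thesis using lt[OF n(1,3)] n by (simp add: disjnt_def)
    next
      case greater then show ?thesis using lt[OF n(3,1)] n by (simp add: disjnt_def Int_commute)
    next
      case equal
      then have "x \<noteq> x'" using n \<open>A \<noteq> B\<close> by auto
      then show ?thesis using Y_sep[of x "L n" "M n" x'] S(1)[OF n(1)] S(1)[OF n(3)] equal n
        by (auto simp: disjnt_def)
    qed
  qed
  note blocks = equiv_disjoint_blocks[OF this F_def]
  have dom: "Domain F = (\<Union>n. \<Union>(tile (L n) ` S n))" using blocks(1) by (auto simp: \<A>_def)
  have cl: "\<exists>n x. x \<in> S n \<and> F `` {y} = tile (L n) x" if y: "y \<in> Domain F" for y
  proof -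
    obtain n x where nx: "x \<in> S n" "y \<in> tile (L n) x" using y unfolding dom by blast
    then have "tile (L n) x \<in> \<A>" by (auto simp: \<A>_def)
    then show ?thesis using blocks(3) nx by blast
  qed
  show thesis
  proof (rule that[of F])
    have "(\<Union>k\<in>set (L n). \<gamma> k ` S n) \<in> sets borel" for n
      by (rule sets.finite_UN) (auto intro: image_\<gamma>_borel S_borel)
    then show "Domain F \<in> sets borel" unfolding dom tiles_UN
      by (intro sets.countable_UN) auto
    show "equiv (Domain F) F" using blocks(1,2) by simp
    show "good \<theta> R (F `` {y})" if "y \<in> Domain F" for y using cl[OF that] S(2) by auto
    show "Domain F \<inter> U0 = {}"
    proof -
      have "tile (L n) x \<inter> U0 = {}" if "x \<in> S n" for n x
        using S(3)[OF that] U_mono[of 0 n] U_0 by auto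
      then show ?thesis unfolding dom by auto
    qed
    show "A \<inter> (U0 \<union> Domain F) \<noteq> {}" if A: "good \<theta> R A" for A
    proof
      assume disj: "A \<inter> (U0 \<union> Domain F) = {}"
      obtain x where "x \<in> A" using A by (auto simp: good_def)
      have "\<exists>k. first k x \<and> \<gamma> k x = y" if "y \<in> A" for y
      proof -
        have "(x, y) \<in> comp_rel G" using A \<open>x \<in> A\<close> that ball_rel_comp_rel by (auto simp: good_def)
        then show ?thesis using first_ex by metis
      qed
      then obtain k where k: "\<And>y. y \<in> A \<Longrightarrow> first (k y) x" "\<And>y. y \<in> A \<Longrightarrow> \<gamma> (k y) x = y" by metis
      have "finite (k ` A)" using A by (simp add: good_def)
      then obtain l where l: "set l = k ` A" using finite_list by blast
      have tl: "tile l x = A" using k(2) by (auto simp: tile_def l image_iff)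
      have inj: "inj_on (\<lambda>k. \<gamma> k x) (set l)" using k(2) by (auto simp: inj_on_def l)
      obtain m where m: "x \<in> Y l m" using Y_cov by blast
      define n where "n = to_nat (l, m)"
      have n: "L n = l" "M n = m" by (simp_all add: L_def M_def n_def)
      have "U n \<subseteq> U0 \<union> Domain F"
      proof (induction n)
        case (Suc n) then show ?case unfolding U_Suc dom by blast
      qed (simp add: U_0)
      then have "x \<in> S n" using disj m inj A by (auto simp: S_def T_def n tl)
      then have "A \<subseteq> Domain F" using tl n unfolding dom by auto
      then show False using disj \<open>x \<in> A\<close> by auto
    qed
    \<comment> \<open>The base point of a tile is recovered from the first entry of a pair by the
      inverse of some \<open>\<gamma> j\<close>; this writes \<open>F\<close> as a countable union
      of Borel sets.\<close>
    have "F = (\<Union>n. \<Union>j\<in>set (L n). \<Union>k\<in>set (L n). {p. inv (\<gamma> j) (fst p) \<in> S n \<and> snd p = \<gamma> k (inv (\<gamma> j) (fst p))})" (is "_ = ?H")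
    proof
      show "F \<subseteq> ?H" by (auto simp: F_def \<A>_def tile_def) (metis \<gamma>_inv(1))
      show "?H \<subseteq> F"
      proof
        fix p assume "p \<in> ?H"
        then obtain n j k where h: "j \<in> set (L n)" "k \<in> set (L n)" "inv (\<gamma> j) (fst p) \<in> S n" "snd p = \<gamma> k (inv (\<gamma> j) (fst p))"
          by auto
        define x where "x = inv (\<gamma> j) (fst p)"
        have "p = (\<gamma> j x, \<gamma> k x)" using h(4) by (auto simp: x_def intro: prod_eqI)
        then have "p \<in> tile (L n) x \<times> tile (L n) x" using h by (auto simp: tile_def)
        then show "p \<in> F" using h(3) by (auto simp: F_def \<A>_def x_def)
      qed
    qed
    moreover have "{p. inv (\<gamma> j) (fst p) \<in> S n \<and> snd p = \<gamma> k (inv (\<gamma> j) (fst p))} \<in> sets (borel \<Otimes>\<^sub>M borel)" for n j k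
    proof -
      note [measurable] = S_borel
      have [measurable]: "Measurable.pred (borel \<Otimes>\<^sub>M borel) (\<lambda>p. snd p = \<gamma> k (inv (\<gamma> j) (fst p)))"
        by (rule pred_eq_borel) measurable
      have "Measurable.pred (borel \<Otimes>\<^sub>M borel) (\<lambda>p. inv (\<gamma> j) (fst p) \<in> S n \<and> snd p = \<gamma> k (inv (\<gamma> j) (fst p)))"
        by measurable
      then show ?thesis by (simp add: pred_def space_pair_measure)
    qed
    ultimately have "F \<in> sets (borel \<Otimes>\<^sub>M borel)"
      by (simp only:) (intro sets.countable_UN image_subsetI sets.finite_UN, simp_all)
    then show "F \<in> sets borel" by (metis borel_prod)
  qed
qed

end

section \<open>Edge boundaries and uncovered mass\<close>

lemma of_bool_meas [measurable]:
  "Measurable.pred M P \<Longrightarrow> (\<lambda>x. of_bool (P x) :: ennreal) \<in> borel_measurable M"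
  unfolding of_bool_def by measurable

lemma csum_finite:
  assumes "finite S" "\<And>y. \<phi> y \<noteq> 0 \<Longrightarrow> y \<in> S"
  shows "csum \<phi> = (\<Sum>y\<in>S. \<phi> y)"
  by (rule nn_integral_count_space') (use assms in auto)

context borel_orbits
begin

definition outdeg :: "'a set \<Rightarrow> 'a \<Rightarrow> ennreal" where
  "outdeg U x = csum (\<lambda>z. of_bool ((x, z) \<in> G \<and> z \<notin> U))"

text \<open>This is \<open>e\<^sub>\<mu>(U)\<close> of the overview: the expected number of edges by
  which a random point leaves \<open>U\<close>.\<close>

definition outflow :: "'a measure \<Rightarrow> 'a set \<Rightarrow> ennreal" where
  "outflow \<mu> U = (\<integral>\<^sup>+x. of_bool (x \<in> U) * outdeg U x \<partial>\<mu>)"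

lemma G_comp_rel: "(x, z) \<in> G \<Longrightarrow> (x, z) \<in> comp_rel G"
  by (simp add: comp_rel_def)

lemma outdeg_meas [measurable]:
  assumes [measurable]: "U \<in> sets borel" shows "outdeg U \<in> borel_measurable borel"
  unfolding outdeg_def
  by (rule csum_meas[of "\<lambda>x. x"]) (auto intro: G_comp_rel)

text \<open>Peel off the support, weighted by the minimal positive value of f, and induct.\<close>

lemma level_sets:
  fixes f :: "'a \<Rightarrow> real"
  assumes "finite T" "\<And>x. 0 \<le> f x" "\<And>x. f x \<noteq> 0 \<Longrightarrow> x \<in> T"
    and "\<And>A. A \<subseteq> {x. 0 < f x} \<Longrightarrow> A \<noteq> {} \<Longrightarrow> \<theta> * real (card A) \<le> real (edge_boundary A)"
  shows "\<theta> * (\<Sum>x\<in>T. f x) \<le> (\<Sum>x\<in>T. \<Sum>z\<in>{z. (x, z) \<in> G}. max 0 (f x - f z))"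
  using assms(2-)
proof (induction "card {x. 0 < f x}" arbitrary: f rule: less_induct)
  case less
  define S where "S = {x. 0 < f x}"
  have ST: "S \<subseteq> T" using less.prems(2) by (force simp: S_def)
  have "finite S" using ST assms(1) finite_subset by blast
  show ?case
  proof (cases "S = {}")
    case True
    have "f x = 0" for x
    proof -
      have "x \<notin> S" using True by simp
      then show ?thesis using less.prems(1)[of x] by (simp add: S_def)
    qed
    then show ?thesis by simp
  next
    case False
    define m where "m = Min (f ` S)"
    have m_le: "m \<le> f x" if "x \<in> S" for x using that \<open>finite S\<close> by (simp add: m_def)
    have "m \<in> f ` S" unfolding m_def using \<open>finite S\<close> False by (intro Min_in) auto
    then obtain x0 where x0: "x0 \<in> S" "f x0 = m" by auto
    have "m > 0" using x0 by (auto simp: S_def)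
    have out: "f x = 0" if "x \<notin> S" for x using that less.prems(1)[of x] by (auto simp: S_def)
    define f' where "f' x = (if x \<in> S then f x - m else 0)" for x
    \<comment> \<open>The minimum is attained at \<open>x0\<close>, so the support strictly shrinks
      and the induction on its size proceeds.\<close>
    have f'_le: "{x. 0 < f' x} \<subseteq> S - {x0}" using x0 by (auto simp: f'_def split: if_splits)
    have "card {x. 0 < f' x} < card S"
      using f'_le x0(1) \<open>finite S\<close> by (intro psubset_card_mono) auto
    then have IH: "\<theta> * (\<Sum>x\<in>T. f' x) \<le> (\<Sum>x\<in>T. \<Sum>z\<in>{z. (x, z) \<in> G}. max 0 (f' x - f' z))"
      unfolding S_def
    proof (rule less.hyps)
      show "0 \<le> f' x" for x using m_le by (simp add: f'_def)
      show "x \<in> T" if "f' x \<noteq> 0" for x using that ST by (auto simp: f'_def split: if_splits)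
      show "\<theta> * real (card A) \<le> real (edge_boundary A)" if "A \<subseteq> {x. 0 < f' x}" "A \<noteq> {}" for A
        using less.prems(3)[of A] that f'_le by (auto simp: S_def)
    qed
    have "(\<Sum>x\<in>T. f x) = (\<Sum>x\<in>T. f' x + (if x \<in> S then m else 0))"
      by (intro sum.cong) (auto simp: f'_def out)
    also have "\<dots> = (\<Sum>x\<in>T. f' x) + m * real (card S)"
      using ST assms(1) by (simp add: sum.distrib sum.If_cases Int_absorb1)
    finally have 1: "(\<Sum>x\<in>T. f x) = (\<Sum>x\<in>T. f' x) + m * real (card S)" .
    have inner: "(\<Sum>z\<in>{z. (x, z) \<in> G}. max 0 (f x - f z)) =
      (\<Sum>z\<in>{z. (x, z) \<in> G}. max 0 (f' x - f' z)) + (if x \<in> S then m * real (card {z. (x, z) \<in> G \<and> z \<notin> S}) else 0)" for x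
    proof -
      have "(\<Sum>z\<in>{z. (x, z) \<in> G}. max 0 (f x - f z)) =
        (\<Sum>z\<in>{z. (x, z) \<in> G}. max 0 (f' x - f' z) + (if x \<in> S \<and> z \<notin> S then m else 0))"
      proof (rule sum.cong[OF refl])
        fix z
        \<comment> \<open>Only an edge from \<open>S\<close> to its complement notices the
          subtraction of \<open>m\<close>: inside \<open>S\<close> differences are unchanged, and
          for \<open>x\<close> outside \<open>S\<close> both positive parts vanish.\<close>
        show "max 0 (f x - f z) = max 0 (f' x - f' z) + (if x \<in> S \<and> z \<notin> S then m else 0)"
          using m_le[of x] m_le[of z] \<open>m > 0\<close> by (auto simp: f'_def out max_def)
      qed
      also have "\<dots> = (\<Sum>z\<in>{z. (x, z) \<in> G}. max 0 (f' x - f' z)) +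
        (\<Sum>z\<in>{z. (x, z) \<in> G}. (if x \<in> S \<and> z \<notin> S then m else 0))"
        by (rule sum.distrib)
      also have "(\<Sum>z\<in>{z. (x, z) \<in> G}. (if x \<in> S \<and> z \<notin> S then m else 0)) =
        (if x \<in> S then m * real (card {z. (x, z) \<in> G \<and> z \<notin> S}) else 0)"
        using G_fin[of x] by (auto simp: sum.If_cases Int_def)
      finally show ?thesis .
    qed
    have "(\<Sum>x\<in>T. \<Sum>z\<in>{z. (x, z) \<in> G}. max 0 (f x - f z)) =
      (\<Sum>x\<in>T. \<Sum>z\<in>{z. (x, z) \<in> G}. max 0 (f' x - f' z)) + (\<Sum>x\<in>T. if x \<in> S then m * real (card {z. (x, z) \<in> G \<and> z \<notin> S}) else 0)"
      unfolding inner by (rule sum.distrib)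
    also have "(\<Sum>x\<in>T. if x \<in> S then m * real (card {z. (x, z) \<in> G \<and> z \<notin> S}) else 0) = m * real (edge_boundary S)"
      using ST assms(1) by (simp add: sum.If_cases Int_absorb1 edge_boundary_def sum_distrib_left)
    finally have 2: "(\<Sum>x\<in>T. \<Sum>z\<in>{z. (x, z) \<in> G}. max 0 (f x - f z)) =
      (\<Sum>x\<in>T. \<Sum>z\<in>{z. (x, z) \<in> G}. max 0 (f' x - f' z)) + m * real (edge_boundary S)" .
    have "\<theta> * real (card S) \<le> real (edge_boundary S)"
      using less.prems(3)[of S] False by (simp add: S_def)
    then have "m * (\<theta> * real (card S)) \<le> m * real (edge_boundary S)" using \<open>m > 0\<close> by simp
    then show ?thesis using IH unfolding 1 2 by (simp add: algebra_simps)
  qed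
qed

end

section \<open>Estimates for an invariant measure\<close>

locale invariant_orbits = borel_orbits G \<gamma> + prob_space \<mu>
  for G :: "('a::polish_space \<times> 'a) set" and \<gamma> and \<mu> :: "'a measure" +
  assumes sets_\<mu>: "sets \<mu> = sets borel" and invariant: "invariant_measure G \<mu>"
begin

lemmas transport = mass_transport[OF prob_space_axioms sets_\<mu> invariant]

lemma sets_\<mu>_cong [measurable_cong]: "sets \<mu> = sets borel"
  by (rule sets_\<mu>)

lemma space_\<mu> [simp]: "space \<mu> = UNIV"
  using sets_\<mu> by (metis sets_eq_imp_space_eq space_borel)

text \<open>The bound on a tile is an average over its points, which single points may exceed. Mass
  transport averages within tiles without changing the integral.\<close>

lemma tiles_outflow:
  assumes F: "F \<in> sets borel" "Domain F \<in> sets borel" "equiv (Domain F) F"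
    and good: "\<And>y. y \<in> Domain F \<Longrightarrow> good \<theta> R (F `` {y})"
  shows "(\<integral>\<^sup>+x. of_bool (x \<in> Domain F) * csum (\<lambda>z. of_bool ((x, z) \<in> G \<and> (x, z) \<notin> F)) \<partial>\<mu>)
    \<le> ennreal \<theta> * emeasure \<mu> (Domain F)"
proof -
  have [measurable]: "F \<in> sets (borel \<Otimes>\<^sub>M borel)" using F(1) borel_prod by metis
  note [measurable] = F(2)
  define esc where "esc x = csum (\<lambda>z. of_bool ((x, z) \<in> G \<and> (x, z) \<notin> F))" for x
  define c where "c x = csum (\<lambda>z. of_bool ((x, z) \<in> F))" for x
  have fin: "finite (F `` {x})" for x
    using good[of x] by (cases "x \<in> Domain F") (auto simp: good_def Image_def Domain_iff)
  have sym: "(x, y) \<in> F \<Longrightarrow> (y, x) \<in> F" for x y using F(3) by (meson equivE symD)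
  have cls: "F `` {x} = F `` {y}" if "(x, y) \<in> F" for x y
    using equiv_class_eq[OF F(3) that] .
  have self: "x \<in> F `` {x}" if "x \<in> Domain F" for x
    using equiv_class_self[OF F(3) that] .
  have FE: "(x, y) \<in> comp_rel G" if "(x, y) \<in> F" for x y
  proof -
    have "x \<in> Domain F" using that by blast
    then have "(x, y) \<in> ball_rel R" using good[of x] self[of x] that by (auto simp: good_def)
    then show ?thesis using ball_rel_comp_rel by blast
  qed
  have [measurable]: "esc \<in> borel_measurable borel" unfolding esc_def
    by (rule csum_meas[of "\<lambda>x. x"]) (auto intro: G_comp_rel)
  have [measurable]: "c \<in> borel_measurable borel" unfolding c_def
    by (rule csum_meas[of "\<lambda>x. x"]) (auto intro: FE)
  have c_card: "c x = ennreal (real (card (F `` {x})))" for x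
  proof -
    have eq: "{z. (x, z) \<in> F} = F `` {x}" by auto
    have "c x = of_nat (card {z. (x, z) \<in> F})"
      unfolding c_def by (rule csum_indicator) (use fin[of x] in \<open>simp add: eq\<close>)
    then show ?thesis by (simp add: eq ennreal_of_nat_eq_real_of_nat)
  qed
  have c_pos: "0 < real (card (F `` {x}))" if "x \<in> Domain F" for x
    using fin[of x] self[OF that] by (auto simp: card_gt_0_iff)
  have esc_card: "esc x = ennreal (real (card {z. (x, z) \<in> G \<and> (x, z) \<notin> F}))" for x
  proof -
    have "esc x = of_nat (card {z. (x, z) \<in> G \<and> (x, z) \<notin> F})"
      unfolding esc_def by (rule csum_indicator) (rule finite_subset[OF _ G_fin[of x]], auto)
    then show ?thesis by (simp add: ennreal_of_nat_eq_real_of_nat)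
  qed
  \<comment> \<open>each point spreads its boundary edges evenly over its tile\<close>
  define \<phi> where "\<phi> x y = of_bool ((x, y) \<in> F) * (esc x / c x)" for x y
  have "(\<integral>\<^sup>+x. csum (\<lambda>y. \<phi> x y) \<partial>\<mu>) = (\<integral>\<^sup>+y. csum (\<lambda>x. \<phi> x y) \<partial>\<mu>)"
  proof (rule transport)
    show "(\<lambda>p. \<phi> (fst p) (snd p)) \<in> borel_measurable (borel \<Otimes>\<^sub>M borel)"
      unfolding \<phi>_def by measurable
  qed (auto simp: \<phi>_def intro: FE split: if_splits)
  moreover have "csum (\<lambda>y. \<phi> x y) = of_bool (x \<in> Domain F) * esc x" for x
  proof (cases "x \<in> Domain F")
    case True
    have "csum (\<lambda>y. \<phi> x y) = c x * (esc x / c x)"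
      unfolding \<phi>_def c_def by (rule nn_integral_multc) auto
    also have "\<dots> = esc x"
      using c_pos[OF True] by (simp add: c_card esc_card divide_ennreal ennreal_mult'[symmetric])
    finally show ?thesis using True by simp
  next
    case False
    then have "\<phi> x y = 0" for y by (auto simp: \<phi>_def)
    then show ?thesis using False by simp
  qed
  \<comment> \<open>What \<open>y\<close> receives is \<open>edge_boundary A / card A\<close> for
    its tile \<open>A\<close>.\<close>
  moreover have "csum (\<lambda>x. \<phi> x y) \<le> ennreal \<theta> * indicator (Domain F) y" for y
  proof (cases "y \<in> Domain F")
    case True
    define A where "A = F `` {y}"
    have A: "finite A" "good \<theta> R A" using fin good[OF True] by (auto simp: A_def)
    have FA: "F `` {x} = A" if "x \<in> A" for x using cls[of y x] that by (simp add: A_def)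
    have cA: "0 < real (card A)" using c_pos[OF True] by (simp add: A_def)
    have "csum (\<lambda>x. \<phi> x y) = (\<Sum>x\<in>A. \<phi> x y)"
      by (rule csum_finite) (use A sym in \<open>auto simp: \<phi>_def A_def split: if_splits\<close>)
    also have "\<dots> = (\<Sum>x\<in>A. ennreal (real (card {z. (x, z) \<in> G \<and> z \<notin> A}) / real (card A)))"
    proof (rule sum.cong[OF refl])
      fix x assume x: "x \<in> A"
      have "(x, y) \<in> F" using x sym by (simp add: A_def)
      moreover have "(x, z) \<in> F \<longleftrightarrow> z \<in> A" for z using FA[OF x] by auto
      ultimately show "\<phi> x y = ennreal (real (card {z. (x, z) \<in> G \<and> z \<notin> A}) / real (card A))"
        using cA by (simp add: \<phi>_def esc_card c_card FA[OF x] divide_ennreal)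
    qed
    also have "\<dots> = ennreal (\<Sum>x\<in>A. real (card {z. (x, z) \<in> G \<and> z \<notin> A}) / real (card A))"
      by (rule sum_ennreal) simp
    also have "(\<Sum>x\<in>A. real (card {z. (x, z) \<in> G \<and> z \<notin> A}) / real (card A)) = real (edge_boundary A) / real (card A)"
      by (simp add: edge_boundary_def sum_divide_distrib)
    also have "\<dots> \<le> \<theta>" using A(2) cA by (simp add: good_def field_simps)
    finally show ?thesis using True by (simp add: ennreal_leI)
  next
    case False
    then have "\<phi> x y = 0" for x using sym by (auto simp: \<phi>_def)
    then show ?thesis by simp
  qed
  ultimately have "(\<integral>\<^sup>+x. of_bool (x \<in> Domain F) * esc x \<partial>\<mu>) \<le> (\<integral>\<^sup>+y. ennreal \<theta> * indicator (Domain F) y \<partial>\<mu>)"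
    by (simp add: nn_integral_mono)
  also have "\<dots> = ennreal \<theta> * emeasure \<mu> (Domain F)"
    by (rule nn_integral_cmult_indicator) measurable
  finally show ?thesis by (simp add: esc_def)
qed

text \<open>Enlarging \<open>U\<close> can only remove outgoing edges of its old points, and an edge
  that leaves the union from a tile leaves that tile.\<close>

lemma outflow_union:
  assumes F: "F \<in> sets borel" "Domain F \<in> sets borel" "equiv (Domain F) F"
    and good: "\<And>y. y \<in> Domain F \<Longrightarrow> good \<theta> R (F `` {y})" and U: "U \<in> sets borel"
  shows "outflow \<mu> (U \<union> Domain F) \<le> outflow \<mu> U + ennreal \<theta> * emeasure \<mu> (Domain F)"
proof -
  have [measurable]: "F \<in> sets (borel \<Otimes>\<^sub>M borel)" using F(1) borel_prod by metis
  note [measurable] = F(2) U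
  define esc where "esc x = csum (\<lambda>z. of_bool ((x, z) \<in> G \<and> (x, z) \<notin> F))" for x
  have [measurable]: "esc \<in> borel_measurable borel" unfolding esc_def
    by (rule csum_meas[of "\<lambda>x. x"]) (auto intro: G_comp_rel)
  have "of_bool (x \<in> U \<union> Domain F) * outdeg (U \<union> Domain F) x
    \<le> of_bool (x \<in> U) * outdeg U x + of_bool (x \<in> Domain F) * esc x" for x
  proof -
    have 1: "outdeg (U \<union> Domain F) x \<le> outdeg U x"
      unfolding outdeg_def by (rule nn_integral_mono) auto
    have "(x, z) \<in> F \<Longrightarrow> z \<in> Domain F" for z using F(3) by (meson DomainI equivE symD)
    then have 2: "outdeg (U \<union> Domain F) x \<le> esc x"
      unfolding outdeg_def esc_def by (intro nn_integral_mono) auto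
    show ?thesis
    proof (cases "x \<in> U")
      case True
      have "outdeg U x \<le> outdeg U x + of_bool (x \<in> Domain F) * esc x" by simp
      with 1 have "outdeg (U \<union> Domain F) x \<le> outdeg U x + of_bool (x \<in> Domain F) * esc x"
        by (rule order_trans)
      then show ?thesis using True by simp
    next
      case False
      then show ?thesis using 2 by (cases "x \<in> Domain F") simp_all
    qed
  qed
  then have "outflow \<mu> (U \<union> Domain F) \<le> (\<integral>\<^sup>+x. of_bool (x \<in> U) * outdeg U x + of_bool (x \<in> Domain F) * esc x \<partial>\<mu>)"
    unfolding outflow_def by (rule nn_integral_mono)
  also have "\<dots> = outflow \<mu> U + (\<integral>\<^sup>+x. of_bool (x \<in> Domain F) * esc x \<partial>\<mu>)"
    unfolding outflow_def by (rule nn_integral_add) measurable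
  also have "(\<integral>\<^sup>+x. of_bool (x \<in> Domain F) * esc x \<partial>\<mu>) \<le> ennreal \<theta> * emeasure \<mu> (Domain F)"
    unfolding esc_def by (rule tiles_outflow[OF F good])
  finally show ?thesis by (simp add: add_left_mono)
qed

text \<open>The positive variation of the cut kernel along edges is summed in two ways. For fixed
  \<open>y\<close>, \<open>level_sets\<close> bounds it below by the mass; for fixed
  \<open>x\<close>, it is bounded above by the closeness of \<open>p\<close> at neighbours and by
  the mass lost on edges entering \<open>U\<close>. Mass transport exchanges the two sums. The
  radius is \<open>r + r\<close> because two points within \<open>r\<close> of \<open>y\<close> are
  within \<open>2 * r\<close> of each other.\<close>

lemma uncovered_bound:
  fixes p :: "'a \<Rightarrow> 'a \<Rightarrow> real"
  assumes p_meas: "(\<lambda>w. p (fst w) (snd w)) \<in> borel_measurable (borel \<Otimes>\<^sub>M borel)"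
    and p_nonneg: "\<And>x y. 0 \<le> p x y" and p_supp: "\<And>x y. p x y \<noteq> 0 \<Longrightarrow> (x, y) \<in> ball_rel r"
    and p_sum: "\<And>x. csum (\<lambda>y. ennreal (p x y)) = 1"
    and p_var: "\<And>x z. (x, z) \<in> G \<Longrightarrow> csum (\<lambda>y. ennreal \<bar>p x y - p z y\<bar>) \<le> ennreal \<eta>"
    and deg: "\<And>x. card {y. (x, y) \<in> G} \<le> D"
    and U: "U \<in> sets borel" and maximal: "\<And>A. good \<theta> (r + r) A \<Longrightarrow> A \<inter> U \<noteq> {}"
    and "0 \<le> \<theta>" "0 \<le> \<eta>"
  shows "ennreal \<theta> * emeasure \<mu> (- U) \<le> ennreal (real D * \<eta>) + outflow \<mu> U"
proof -
  note [measurable] = U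
  define q where "q x y = (if x \<in> U then 0 else p x y)" for x y
  have pm [measurable]: "(\<lambda>w. p (f w) (g w)) \<in> borel_measurable M"
    if [measurable]: "f \<in> borel_measurable M" "g \<in> borel_measurable M" for f g and M :: "'c measure"
  proof -
    have "(\<lambda>w. (f w, g w)) \<in> M \<rightarrow>\<^sub>M borel \<Otimes>\<^sub>M borel" by measurable
    from measurable_compose[OF this p_meas] show ?thesis by simp
  qed
  have qm [measurable]: "(\<lambda>w. q (f w) (g w)) \<in> borel_measurable M"
    if [measurable]: "f \<in> borel_measurable M" "g \<in> borel_measurable M" for f g and M :: "'c measure"
    unfolding q_def by measurable
  have q_nonneg: "0 \<le> q x y" for x y using p_nonneg by (simp add: q_def)
  have q_supp: "(x, y) \<in> ball_rel r" if "q x y \<noteq> 0" for x y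
    using that p_supp by (auto simp: q_def split: if_splits)
  have q_comp': "(x, y) \<in> comp_rel G" if "q x y \<noteq> 0" for x y
    using q_supp[OF that] ball_rel_comp_rel by blast
  have q_comp: "(x, y) \<in> comp_rel G" if "ennreal (q x y) \<noteq> 0" for x y
    by (rule q_comp') (use that in auto)
  \<comment> \<open>\<open>ennreal\<close> sends negative reals to 0, so this is the positive part
    of the drop from \<open>x\<close> to \<open>z\<close>.\<close>
  define d where "d x y = csum (\<lambda>z. of_bool ((x, z) \<in> G) * ennreal (q x y - q z y))" for x y
  have d_sum: "d x y = (\<Sum>z\<in>{z. (x, z) \<in> G}. ennreal (q x y - q z y))" for x y
  proof -
    have "d x y = (\<Sum>z\<in>{z. (x, z) \<in> G}. of_bool ((x, z) \<in> G) * ennreal (q x y - q z y))"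
      unfolding d_def by (rule csum_finite[OF G_fin]) (auto split: if_splits)
    then show ?thesis by simp
  qed
  have d_supp: "q x y \<noteq> 0" if "d x y \<noteq> 0" for x y
  proof
    assume "q x y = 0"
    then have "d x y = 0" unfolding d_sum using q_nonneg by (intro sum.neutral) (auto simp: ennreal_neg)
    then show False using that by simp
  qed
  have level: "ennreal \<theta> * csum (\<lambda>x. ennreal (q x y)) \<le> csum (\<lambda>x. d x y)" for y
  proof -
    define S where "S = {x. (x, y) \<in> ball_rel r}"
    have "S = {x. (y, x) \<in> ball_rel r}" using ball_rel_sym by (auto simp: S_def)
    then have S: "finite S" using finite_ball_rel by simp
    have "\<theta> * (\<Sum>x\<in>S. q x y) \<le> (\<Sum>x\<in>S. \<Sum>z\<in>{z. (x, z) \<in> G}. max 0 (q x y - q z y))"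
    proof (rule level_sets[OF S])
      show "x \<in> S" if "q x y \<noteq> 0" for x using q_supp[OF that] by (simp add: S_def)
      fix A assume A: "A \<subseteq> {x. 0 < q x y}" "A \<noteq> {}"
      have AS: "A \<subseteq> S"
      proof
        fix x assume "x \<in> A"
        then have "q x y \<noteq> 0" using A by auto
        then show "x \<in> S" using q_supp by (simp add: S_def)
      qed
      have "A \<inter> U = {}" using A by (auto simp: q_def)
      then have "\<not> good \<theta> (r + r) A" using maximal by blast
      moreover have "finite A" using AS S finite_subset by blast
      moreover have "(x, x') \<in> ball_rel (r + r)" if "x \<in> A" "x' \<in> A" for x x'
        using that AS ball_rel_sym by (intro ball_rel_trans[of x y r x' r]) (auto simp: S_def)
      ultimately show "\<theta> * real (card A) \<le> real (edge_boundary A)"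
        using A(2) by (auto simp: good_def)
    qed (rule q_nonneg)
    then have "ennreal (\<theta> * (\<Sum>x\<in>S. q x y)) \<le> ennreal (\<Sum>x\<in>S. \<Sum>z\<in>{z. (x, z) \<in> G}. max 0 (q x y - q z y))"
      by (rule ennreal_leI)
    also have "ennreal (\<Sum>x\<in>S. \<Sum>z\<in>{z. (x, z) \<in> G}. max 0 (q x y - q z y)) = (\<Sum>x\<in>S. d x y)"
    proof -
      have "ennreal (max 0 a) = ennreal a" for a :: real by (simp add: max_def ennreal_neg)
      then show ?thesis unfolding d_sum
        by (subst sum_ennreal[symmetric]) (auto intro!: sum_nonneg sum.cong simp: sum_ennreal[symmetric])
    qed
    also have "(\<Sum>x\<in>S. d x y) = csum (\<lambda>x. d x y)"
    proof (rule csum_finite[symmetric, OF S])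
      fix x assume "d x y \<noteq> 0"
      then show "x \<in> S" using q_supp[OF d_supp] by (simp add: S_def)
    qed
    also have "ennreal (\<theta> * (\<Sum>x\<in>S. q x y)) = ennreal \<theta> * csum (\<lambda>x. ennreal (q x y))"
    proof -
      have "csum (\<lambda>x. ennreal (q x y)) = (\<Sum>x\<in>S. ennreal (q x y))"
      proof (rule csum_finite[OF S])
        fix x assume "ennreal (q x y) \<noteq> 0"
        then have "q x y \<noteq> 0" by auto
        then show "x \<in> S" using q_supp by (simp add: S_def)
      qed
      then show ?thesis using q_nonneg \<open>0 \<le> \<theta>\<close> by (simp add: sum_ennreal ennreal_mult' sum_nonneg)
    qed
    finally show ?thesis .
  qed
  have dm: "(\<lambda>w. d (fst w) (snd w)) \<in> borel_measurable (borel \<Otimes>\<^sub>M borel)"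
    unfolding d_def
    by (rule csum_meas[of fst]) (auto intro: G_comp_rel split: if_splits)
  have mass: "(\<integral>\<^sup>+y. csum (\<lambda>x. ennreal (q x y)) \<partial>\<mu>) = emeasure \<mu> (- U)"
  proof -
    have "(\<integral>\<^sup>+y. csum (\<lambda>x. ennreal (q x y)) \<partial>\<mu>) = (\<integral>\<^sup>+x. csum (\<lambda>y. ennreal (q x y)) \<partial>\<mu>)"
    proof (rule transport[symmetric])
      show "(\<lambda>w. ennreal (q (fst w) (snd w))) \<in> borel_measurable (borel \<Otimes>\<^sub>M borel)" by measurable
    qed (rule q_comp)
    also have "\<dots> = (\<integral>\<^sup>+x. indicator (- U) x \<partial>\<mu>)"
      using p_sum by (intro nn_integral_cong) (simp add: q_def indicator_def)
    finally show ?thesis by simp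
  qed
  have bound: "csum (\<lambda>y. d x y) \<le> ennreal (real D * \<eta>) + csum (\<lambda>z. of_bool ((x, z) \<in> G \<and> x \<notin> U \<and> z \<in> U))" for x
  proof -
    have "csum (\<lambda>y. d x y) = (\<Sum>z\<in>{z. (x, z) \<in> G}. csum (\<lambda>y. ennreal (q x y - q z y)))"
      unfolding d_sum by (rule nn_integral_sum) simp
    also have "\<dots> \<le> (\<Sum>z\<in>{z. (x, z) \<in> G}. ennreal \<eta> + of_bool ((x, z) \<in> G \<and> x \<notin> U \<and> z \<in> U))"
    proof (rule sum_mono)
      fix z assume z: "z \<in> {z. (x, z) \<in> G}"
      \<comment> \<open>From inside \<open>U\<close> nothing can drop; an edge entering
        \<open>U\<close> loses the whole unit mass of \<open>p x\<close>; an edge outside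
        \<open>U\<close> costs at most \<open>\<eta>\<close>.\<close>
      consider "x \<in> U" | "x \<notin> U" "z \<in> U" | "x \<notin> U" "z \<notin> U" by blast
      then show "csum (\<lambda>y. ennreal (q x y - q z y)) \<le> ennreal \<eta> + of_bool ((x, z) \<in> G \<and> x \<notin> U \<and> z \<in> U)"
      proof cases
        case 1
        then have "ennreal (q x y - q z y) = 0" for y using q_nonneg[of z y] by (simp add: q_def ennreal_neg)
        then show ?thesis by simp
      next
        case 2
        then show ?thesis using z p_sum[of x] by (simp add: q_def add_increasing)
      next
        case 3
        have "csum (\<lambda>y. ennreal (q x y - q z y)) \<le> csum (\<lambda>y. ennreal \<bar>p x y - p z y\<bar>)"
          using 3 by (intro nn_integral_mono) (auto simp: q_def intro!: ennreal_leI)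
        also have "\<dots> \<le> ennreal \<eta>" using p_var z by simp
        finally show ?thesis by (simp add: add_increasing2)
      qed
    qed
    also have "\<dots> = of_nat (card {z. (x, z) \<in> G}) * ennreal \<eta> + (\<Sum>z\<in>{z. (x, z) \<in> G}. of_bool ((x, z) \<in> G \<and> x \<notin> U \<and> z \<in> U))"
      by (simp add: sum.distrib)
    also have "(\<Sum>z\<in>{z. (x, z) \<in> G}. of_bool ((x, z) \<in> G \<and> x \<notin> U \<and> z \<in> U)) = csum (\<lambda>z. of_bool ((x, z) \<in> G \<and> x \<notin> U \<and> z \<in> U))"
      by (rule csum_finite[symmetric, OF G_fin]) (auto split: if_splits)
    also have "of_nat (card {z. (x, z) \<in> G}) * ennreal \<eta> \<le> ennreal (real D * \<eta>)"
    proof -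
      have "of_nat (card {z. (x, z) \<in> G}) * ennreal \<eta> = ennreal (real (card {z. (x, z) \<in> G}) * \<eta>)"
        using \<open>0 \<le> \<eta>\<close> by (simp add: ennreal_of_nat_eq_real_of_nat ennreal_mult')
      also have "\<dots> \<le> ennreal (real D * \<eta>)"
        using deg[of x] \<open>0 \<le> \<eta>\<close> by (intro ennreal_leI mult_right_mono) auto
      finally show ?thesis .
    qed
    finally show ?thesis by (simp add: add_right_mono)
  qed
  \<comment> \<open>Transport moves the count from the outer ends of the edges to their ends in
    \<open>U\<close>, where symmetry of \<open>G\<close> makes it the outflow.\<close>
  have inflow: "(\<integral>\<^sup>+x. csum (\<lambda>z. of_bool ((x, z) \<in> G \<and> x \<notin> U \<and> z \<in> U)) \<partial>\<mu>) = outflow \<mu> U"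
  proof -
    have "(\<integral>\<^sup>+x. csum (\<lambda>z. of_bool ((x, z) \<in> G \<and> x \<notin> U \<and> z \<in> U)) \<partial>\<mu>) =
      (\<integral>\<^sup>+z. csum (\<lambda>x. of_bool ((x, z) \<in> G \<and> x \<notin> U \<and> z \<in> U)) \<partial>\<mu>)"
      by (rule transport) (auto intro: G_comp_rel)
    also have "\<dots> = outflow \<mu> U"
      unfolding outflow_def outdeg_def
    proof (rule nn_integral_cong)
      fix z
      have "(x, z) \<in> G \<longleftrightarrow> (z, x) \<in> G" for x using G_sym by (meson symD)
      then show "csum (\<lambda>x. of_bool ((x, z) \<in> G \<and> x \<notin> U \<and> z \<in> U)) = of_bool (z \<in> U) * csum (\<lambda>x. of_bool ((z, x) \<in> G \<and> x \<notin> U))"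
        by (cases "z \<in> U") simp_all
    qed
    finally show ?thesis .
  qed
  have "ennreal \<theta> * emeasure \<mu> (- U) = (\<integral>\<^sup>+y. ennreal \<theta> * csum (\<lambda>x. ennreal (q x y)) \<partial>\<mu>)"
    unfolding mass[symmetric]
  proof (rule nn_integral_cmult[symmetric])
    have "(\<lambda>y. csum (\<lambda>x. ennreal (q x y))) \<in> borel_measurable borel"
    proof (rule csum_meas[of "\<lambda>x. x"])
      show "(\<lambda>w. ennreal (q (snd w) (fst w))) \<in> borel_measurable (borel \<Otimes>\<^sub>M borel)" by measurable
    qed (use q_comp comp_rel_sym in \<open>auto simp del: ennreal_eq_0_iff\<close>)
    then show "(\<lambda>y. csum (\<lambda>x. ennreal (q x y))) \<in> borel_measurable \<mu>"
      by (simp cong: measurable_cong_sets)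
  qed
  also have "\<dots> \<le> (\<integral>\<^sup>+y. csum (\<lambda>x. d x y) \<partial>\<mu>)"
    by (rule nn_integral_mono) (rule level)
  also have "\<dots> = (\<integral>\<^sup>+x. csum (\<lambda>y. d x y) \<partial>\<mu>)"
    by (rule transport[symmetric, OF dm]) (use d_supp q_comp' in blast)
  also have "\<dots> \<le> (\<integral>\<^sup>+x. ennreal (real D * \<eta>) + csum (\<lambda>z. of_bool ((x, z) \<in> G \<and> x \<notin> U \<and> z \<in> U)) \<partial>\<mu>)"
    by (rule nn_integral_mono) (rule bound)
  also have "\<dots> = ennreal (real D * \<eta>) + outflow \<mu> U"
  proof -
    have "(\<lambda>x. csum (\<lambda>z. of_bool ((x, z) \<in> G \<and> x \<notin> U \<and> z \<in> U))) \<in> borel_measurable borel"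
      by (rule csum_meas[of "\<lambda>x. x"]) (auto intro: G_comp_rel)
    then have [measurable]: "(\<lambda>x. csum (\<lambda>z. of_bool ((x, z) \<in> G \<and> x \<notin> U \<and> z \<in> U))) \<in> borel_measurable \<mu>"
      by (simp cong: measurable_cong_sets)
    show ?thesis by (subst nn_integral_add) (simp_all add: inflow emeasure_space_1[simplified])
  qed
  finally show ?thesis .
qed

end

section \<open>Iteration\<close>

lemma equiv_Un_disjoint:
  assumes E: "equiv (Domain E) E" and F: "equiv (Domain F) F" and disj: "Domain F \<inter> Domain E = {}"
  shows "equiv (Domain (E \<union> F)) (E \<union> F)"
    "\<And>y. y \<in> Domain E \<Longrightarrow> (E \<union> F) `` {y} = E `` {y}" "\<And>y. y \<in> Domain F \<Longrightarrow> (E \<union> F) `` {y} = F `` {y}"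
proof -
  have E': "refl_on (Domain E) E" "sym E" "trans E" "E \<subseteq> Domain E \<times> Domain E"
    and F': "refl_on (Domain F) F" "sym F" "trans F" "F \<subseteq> Domain F \<times> Domain F"
    using E F by (auto elim!: equivE)
  show "equiv (Domain (E \<union> F)) (E \<union> F)"
  proof (rule equivI)
    show "E \<union> F \<subseteq> Domain (E \<union> F) \<times> Domain (E \<union> F)" using E'(4) F'(4) by auto
    show "refl_on (Domain (E \<union> F)) (E \<union> F)" using E'(1) F'(1) by (auto simp: refl_on_def)
    show "sym (E \<union> F)" using E'(2) F'(2) by (rule sym_Un)
    show "trans (E \<union> F)"
    proof (rule transI)
      fix x y z assume "(x, y) \<in> E \<union> F" "(y, z) \<in> E \<union> F"
      then consider "(x, y) \<in> E" "(y, z) \<in> E" | "(x, y) \<in> F" "(y, z) \<in> F"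
        | "y \<in> Domain E" "y \<in> Domain F"
        using E'(4) F'(4) by blast
      then show "(x, z) \<in> E \<union> F"
        using E'(3) F'(3) disj by cases (auto dest: transD)
    qed
  qed
  show "(E \<union> F) `` {y} = E `` {y}" if "y \<in> Domain E" for y using that disj by auto
  show "(E \<union> F) `` {y} = F `` {y}" if "y \<in> Domain F" for y using that disj by auto
qed

context borel_orbits
begin

lemma good_mono:
  assumes "good \<theta> R A" "\<theta> \<le> \<theta>'" "R \<le> R'" shows "good \<theta>' R' A"
proof -
  have "\<theta> * real (card A) \<le> \<theta>' * real (card A)" using assms(2) by (intro mult_right_mono) auto
  then show ?thesis using assms(1) ball_rel_mono[OF assms(3)] by (auto simp: good_def)
qed

text \<open>A boundary vertex carries at least one outgoing edge, so the edge count dominates the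
  vertex count.\<close>

lemma good_folner:
  assumes "good \<epsilon> R A" shows "folner_set G \<epsilon> A"
proof -
  have A: "finite A" "A \<noteq> {}" "real (edge_boundary A) < \<epsilon> * real (card A)" using assms by (auto simp: good_def)
  have "card (boundary G A) = (\<Sum>x\<in>A. if \<exists>y. (x, y) \<in> G \<and> y \<notin> A then 1 else 0)"
    using A(1) by (simp add: boundary_def sum.If_cases Int_def)
  also have "\<dots> \<le> edge_boundary A"
    unfolding edge_boundary_def
  proof (rule sum_mono)
    fix x
    have "finite {z. (x, z) \<in> G \<and> z \<notin> A}" by (rule finite_subset[OF _ G_fin[of x]]) auto
    then show "(if \<exists>y. (x, y) \<in> G \<and> y \<notin> A then 1 else 0) \<le> card {z. (x, z) \<in> G \<and> z \<notin> A}"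
      by (auto simp: Suc_le_eq card_gt_0_iff)
  qed
  finally have "real (card (boundary G A)) < \<epsilon> * real (card A)" using A(3) by linarith
  moreover have "real (card A) > 0" using A by (simp add: card_gt_0_iff)
  ultimately show ?thesis using A by (simp add: folner_set_def pos_divide_less_eq)
qed

text \<open>The amenability data in the form suited to integration: extended by zero to all pairs,
  summed in \<open>ennreal\<close>, with the support bounded by \<open>ball_rel\<close>.\<close>

definition kernel :: "real \<Rightarrow> nat \<Rightarrow> ('a \<Rightarrow> 'a \<Rightarrow> real) \<Rightarrow> bool" where
  "kernel \<eta> r p \<longleftrightarrow> (\<lambda>w. p (fst w) (snd w)) \<in> borel_measurable (borel \<Otimes>\<^sub>M borel) \<and>
    (\<forall>x y. 0 \<le> p x y) \<and> (\<forall>x y. p x y \<noteq> 0 \<longrightarrow> (x, y) \<in> ball_rel r) \<and>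
    (\<forall>x. csum (\<lambda>y. ennreal (p x y)) = 1) \<and>
    (\<forall>x z. (x, z) \<in> G \<longrightarrow> csum (\<lambda>y. ennreal \<bar>p x y - p z y\<bar>) \<le> ennreal \<eta>)"

lemma infsum_csum:
  assumes "finite S" "S \<subseteq> T" "\<And>y. y \<in> T - S \<Longrightarrow> h y = 0" "\<And>y. 0 \<le> f y" "\<And>y. y \<in> T \<Longrightarrow> f y = h y" "\<And>y. y \<notin> T \<Longrightarrow> f y = (0::real)"
  shows "csum (\<lambda>y. ennreal (f y)) = ennreal (infsum h T)"
proof -
  have "infsum h T = infsum h S" by (rule infsum_cong_neutral) (use assms in auto)
  also have "\<dots> = (\<Sum>y\<in>S. f y)" using assms by (auto intro!: sum.cong)
  finally have 1: "infsum h T = (\<Sum>y\<in>S. f y)" .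
  have "f y = 0" if "y \<notin> S" for y using that assms(3,5,6)[of y] by (cases "y \<in> T") auto
  then have "csum (\<lambda>y. ennreal (f y)) = (\<Sum>y\<in>S. ennreal (f y))"
    by (intro csum_finite[OF assms(1)]) (metis ennreal_0)
  then show ?thesis unfolding 1 using assms(4) by (simp add: sum_ennreal)
qed

lemma kernel_exists:
  assumes am: "unif_borel_amenable G" and "0 < \<eta>"
  obtains r p where "kernel \<eta> r p"
proof -
  obtain n :: nat where n: "1 / real (Suc n) < \<eta>" using nat_approx_posE[OF \<open>0 < \<eta>\<close>] by blast
  have "\<exists>p :: 'a \<times> 'a \<Rightarrow> real.
       p \<in> borel_measurable (restrict_space borel (comp_rel G)) \<and>
       (\<forall>x y. (x, y) \<in> comp_rel G \<longrightarrow> p (x, y) \<ge> 0) \<and>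
       (\<forall>x. infsum (\<lambda>y. p (x, y)) {y. (x, y) \<in> comp_rel G} = 1) \<and>
       (\<forall>x z. (x, z) \<in> G \<longrightarrow>
          infsum (\<lambda>y. \<bar>p (x, y) - p (z, y)\<bar>) {y. (x, y) \<in> comp_rel G} < 1 / real (Suc n)) \<and>
       (\<exists>r::real. r > 0 \<and> (\<forall>x y. (x, y) \<in> comp_rel G \<and> real (gdist G x y) > r \<longrightarrow> p (x, y) = 0))"
    by (rule am[unfolded unif_borel_amenable_def, THEN conjunct2, THEN spec, THEN mp]) simp
  then obtain p0 :: "'a \<times> 'a \<Rightarrow> real" and r0 :: real where
    p0: "p0 \<in> borel_measurable (restrict_space borel (comp_rel G))"
       "\<And>x y. (x, y) \<in> comp_rel G \<Longrightarrow> p0 (x, y) \<ge> 0"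
       "\<And>x. infsum (\<lambda>y. p0 (x, y)) {y. (x, y) \<in> comp_rel G} = 1"
       "\<And>x z. (x, z) \<in> G \<Longrightarrow> infsum (\<lambda>y. \<bar>p0 (x, y) - p0 (z, y)\<bar>) {y. (x, y) \<in> comp_rel G} < 1 / real (Suc n)"
       "r0 > 0" "\<And>x y. (x, y) \<in> comp_rel G \<Longrightarrow> real (gdist G x y) > r0 \<Longrightarrow> p0 (x, y) = 0"
    by blast
  define r where "r = nat \<lceil>r0\<rceil>"
  define p where "p x y = (if (x, y) \<in> comp_rel G then p0 (x, y) else 0)" for x y
  define S where "S x = {y. (x, y) \<in> ball_rel r}" for x
  have S: "finite (S x)" for x unfolding S_def by (rule finite_ball_rel)
  have S_sub: "S x \<subseteq> {y. (x, y) \<in> comp_rel G}" for x using ball_rel_comp_rel by (auto simp: S_def)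
  have out: "p0 (x, y) = 0" if "(x, y) \<in> comp_rel G" "y \<notin> S x" for x y
  proof (rule p0(6)[OF that(1)], rule ccontr)
    assume "\<not> real (gdist G x y) > r0"
    then have "gdist G x y \<le> r" unfolding r_def by linarith
    moreover have "\<exists>m. (x, y) \<in> G ^^ m" using that(1) unfolding comp_rel_def by (rule rtrancl_imp_relpow)
    then have "(x, y) \<in> G ^^ gdist G x y" unfolding gdist_def by (rule LeastI_ex)
    ultimately have "(x, y) \<in> ball_rel r" unfolding ball_rel_def by blast
    then show False using that(2) by (simp add: S_def)
  qed
  have p_nonneg: "0 \<le> p x y" for x y using p0(2) by (simp add: p_def)
  have "kernel \<eta> r p"
    unfolding kernel_def
  proof (intro conjI allI impI)
    have "comp_rel G \<in> sets borel" using comp_rel_meas borel_prod by metis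
    then have "(\<lambda>w. indicator (comp_rel G) w *\<^sub>R p0 w) \<in> borel_measurable borel"
      using p0(1) by (subst (asm) borel_measurable_restrict_space_iff) auto
    moreover have "(\<lambda>w. indicator (comp_rel G) w *\<^sub>R p0 w) = (\<lambda>w. p (fst w) (snd w))"
      by (auto simp: p_def indicator_def fun_eq_iff)
    ultimately show "(\<lambda>w. p (fst w) (snd w)) \<in> borel_measurable (borel \<Otimes>\<^sub>M borel)"
      by (simp add: borel_prod)
    fix x
    show "0 \<le> p x y" for y by (rule p_nonneg)
    show "(x, y) \<in> ball_rel r" if "p x y \<noteq> 0" for y
      using that out[of x y] by (auto simp: p_def S_def split: if_splits)
    have "csum (\<lambda>y. ennreal (p x y)) = ennreal (infsum (\<lambda>y. p0 (x, y)) {y. (x, y) \<in> comp_rel G})"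
      by (rule infsum_csum[OF S S_sub]) (use out p_nonneg in \<open>auto simp: p_def\<close>)
    then show "csum (\<lambda>y. ennreal (p x y)) = 1" using p0(3) by simp
    fix z assume xz: "(x, z) \<in> G"
    have same: "(x, y) \<in> comp_rel G \<longleftrightarrow> (z, y) \<in> comp_rel G" for y
      using xz G_sym unfolding comp_rel_def by (meson converse_rtrancl_into_rtrancl symD)
    have "csum (\<lambda>y. ennreal \<bar>p x y - p z y\<bar>) = ennreal (infsum (\<lambda>y. \<bar>p0 (x, y) - p0 (z, y)\<bar>) {y. (x, y) \<in> comp_rel G})"
    proof (rule infsum_csum[of "S x \<union> S z"])
      show "finite (S x \<union> S z)" using S by simp
      show "S x \<union> S z \<subseteq> {y. (x, y) \<in> comp_rel G}" using S_sub[of x] S_sub[of z] same by auto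
      show "\<bar>p0 (x, y) - p0 (z, y)\<bar> = 0" if "y \<in> {y. (x, y) \<in> comp_rel G} - (S x \<union> S z)" for y
        using that same[of y] out[of x y] out[of z y] by simp
      show "\<bar>p x y - p z y\<bar> = \<bar>p0 (x, y) - p0 (z, y)\<bar>" if "y \<in> {y. (x, y) \<in> comp_rel G}" for y
        using that same[of y] by (simp add: p_def)
      show "\<bar>p x y - p z y\<bar> = 0" if "y \<notin> {y. (x, y) \<in> comp_rel G}" for y
        using that same[of y] by (simp add: p_def)
    qed simp
    also have "\<dots> \<le> ennreal \<eta>" using p0(4)[OF xz] n by (intro ennreal_leI) linarith
    finally show "csum (\<lambda>y. ennreal \<bar>p x y - p z y\<bar>) \<le> ennreal \<eta>" .
  qed
  then show thesis using that by blast
qed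

definition good_packing :: "real \<Rightarrow> nat \<Rightarrow> ('a \<times> 'a) set \<Rightarrow> bool" where
  "good_packing \<epsilon> R F \<longleftrightarrow> F \<in> sets borel \<and> Domain F \<in> sets borel \<and> equiv (Domain F) F \<and>
    (\<forall>y\<in>Domain F. good \<epsilon> R (F `` {y}))"

text \<open>The error has two parts of size \<open>\<theta> * \<epsilon> / 4\<close>, the variation
  of the kernel and the outflow inherited from \<open>F\<close>; dividing by \<open>\<theta>\<close>
  leaves \<open>\<epsilon> / 2\<close>. The resulting map from \<open>a\<close> to
  \<open>(a + \<epsilon> / 2) / 2\<close> has fixed point \<open>\<epsilon> / 2\<close>, safely
  below \<open>\<epsilon>\<close>.\<close>

lemma packing_step:
  assumes am: "unif_borel_amenable G" and \<epsilon>: "0 < \<epsilon>" "\<epsilon> \<le> 1" and "0 < \<theta>" "\<theta> \<le> \<epsilon>"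
    and F: "good_packing \<epsilon> R F"
  obtains R' F' where "good_packing \<epsilon> R' F'"
    "\<And>\<mu> a. prob_space \<mu> \<Longrightarrow> sets \<mu> = sets borel \<Longrightarrow> invariant_measure G \<mu> \<Longrightarrow>
      outflow \<mu> (Domain F) \<le> ennreal (\<theta> * \<epsilon> / 4) \<Longrightarrow> measure \<mu> (- Domain F) \<le> a \<Longrightarrow>
      outflow \<mu> (Domain F') \<le> ennreal (2 * \<theta>) \<and> measure \<mu> (- Domain F') \<le> (a + \<epsilon> / 2) / 2"
proof -
  obtain D where D: "\<And>x. card {y. (x, y) \<in> G} \<le> D"
    using am unfolding unif_borel_amenable_def bounded_degree_def by blast
  \<comment> \<open>Chosen to make \<open>real D * \<eta>\<close> at most
    \<open>\<theta> * \<epsilon> / 4\<close>; the summand 1 keeps the denominator positive also for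
    \<open>D = 0\<close>.\<close>
  define \<eta> where "\<eta> = \<theta> * \<epsilon> / (4 * (real D + 1))"
  have "0 < \<eta>" using assms by (simp add: \<eta>_def)
  have D\<eta>: "real D * \<eta> \<le> \<theta> * \<epsilon> / 4"
  proof -
    have "real D * \<eta> \<le> (real D + 1) * \<eta>" using \<open>0 < \<eta>\<close> by (simp add: mult_right_mono)
    also have "\<dots> = \<theta> * \<epsilon> / 4" by (simp add: \<eta>_def add_pos_nonneg field_simps)
    finally show ?thesis .
  qed
  obtain r p where p: "kernel \<eta> r p" using kernel_exists[OF am \<open>0 < \<eta>\<close>] by blast
  have FB: "F \<in> sets borel" "Domain F \<in> sets borel" "equiv (Domain F) F"
    "\<And>y. y \<in> Domain F \<Longrightarrow> good \<epsilon> R (F `` {y})" using F by (auto simp: good_packing_def)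
  obtain H where H: "H \<in> sets borel" "Domain H \<in> sets borel" "equiv (Domain H) H" "Domain H \<inter> Domain F = {}"
    "\<And>y. y \<in> Domain H \<Longrightarrow> good \<theta> (r + r) (H `` {y})"
    "\<And>A. good \<theta> (r + r) A \<Longrightarrow> A \<inter> (Domain F \<union> Domain H) \<noteq> {}"
    using greedy_packing[OF FB(2)] by metis
  note un = equiv_Un_disjoint[OF FB(3) H(3,4)]
  have dom: "Domain (F \<union> H) = Domain F \<union> Domain H" by auto
  show thesis
  proof (rule that[of "max R (r + r)" "F \<union> H"])
    have "good \<epsilon> (max R (r + r)) ((F \<union> H) `` {y})" if "y \<in> Domain (F \<union> H)" for y
    proof (cases "y \<in> Domain F")
      case True
      then show ?thesis using good_mono[OF FB(4)[OF True], of \<epsilon> "max R (r + r)"] by (simp add: un(2)[OF True])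
    next
      case False
      then have y: "y \<in> Domain H" using that by (simp add: dom)
      show ?thesis using good_mono[OF H(5)[OF y] \<open>\<theta> \<le> \<epsilon>\<close>, of "max R (r + r)"] by (simp add: un(3)[OF y])
    qed
    then show "good_packing \<epsilon> (max R (r + r)) (F \<union> H)"
      using FB(1,2) H(1,2) un(1) by (auto simp: good_packing_def dom)
    fix \<mu> a assume \<mu>: "prob_space \<mu>" "sets \<mu> = sets borel" "invariant_measure G \<mu>"
      and out: "outflow \<mu> (Domain F) \<le> ennreal (\<theta> * \<epsilon> / 4)" and a: "measure \<mu> (- Domain F) \<le> a"
    interpret invariant_orbits G \<gamma> \<mu>
      by (intro invariant_orbits.intro borel_orbits_axioms \<mu> invariant_orbits_axioms.intro)
    have em: "emeasure \<mu> A = ennreal (measure \<mu> A)" for A by (rule emeasure_eq_measure)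
    have out': "outflow \<mu> (Domain F \<union> Domain H) \<le> ennreal (\<theta> * \<epsilon> / 4 + \<theta> * measure \<mu> (Domain H))"
    proof -
      have "outflow \<mu> (Domain F \<union> Domain H) \<le> outflow \<mu> (Domain F) + ennreal \<theta> * emeasure \<mu> (Domain H)"
        by (rule outflow_union[OF H(1-3,5) FB(2)])
      also have "\<dots> \<le> ennreal (\<theta> * \<epsilon> / 4) + ennreal \<theta> * emeasure \<mu> (Domain H)"
        by (rule add_right_mono[OF out])
      also have "\<dots> = ennreal (\<theta> * \<epsilon> / 4 + \<theta> * measure \<mu> (Domain H))"
        using assms by (simp add: em ennreal_mult' ennreal_plus)
      finally show ?thesis .
    qed
    have UB: "Domain F \<union> Domain H \<in> sets borel" using FB(2) H(2) by simp
    have "ennreal \<theta> * emeasure \<mu> (- (Domain F \<union> Domain H)) \<le> ennreal (real D * \<eta>) + outflow \<mu> (Domain F \<union> Domain H)"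
    proof (rule uncovered_bound[where p = p and r = r])
      show "A \<inter> (Domain F \<union> Domain H) \<noteq> {}" if "good \<theta> (r + r) A" for A by (rule H(6)[OF that])
    qed (use p D UB assms \<open>0 < \<eta>\<close> in \<open>auto simp: kernel_def\<close>)
    also have "\<dots> \<le> ennreal (\<theta> * \<epsilon> / 4) + ennreal (\<theta> * \<epsilon> / 4 + \<theta> * measure \<mu> (Domain H))"
      by (rule add_mono[OF ennreal_leI[OF D\<eta>] out'])
    also have "\<dots> = ennreal (\<theta> * \<epsilon> / 4 + (\<theta> * \<epsilon> / 4 + \<theta> * measure \<mu> (Domain H)))"
      using assms by (intro ennreal_plus[symmetric]) auto
    also have "\<theta> * \<epsilon> / 4 + (\<theta> * \<epsilon> / 4 + \<theta> * measure \<mu> (Domain H)) = \<theta> * (\<epsilon> / 2 + measure \<mu> (Domain H))"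
      by (simp add: algebra_simps)
    also have "ennreal \<theta> * emeasure \<mu> (- (Domain F \<union> Domain H)) = ennreal (\<theta> * measure \<mu> (- (Domain F \<union> Domain H)))"
      using \<open>0 < \<theta>\<close> by (simp add: em ennreal_mult')
    finally have "ennreal (\<theta> * measure \<mu> (- (Domain F \<union> Domain H))) \<le> ennreal (\<theta> * (\<epsilon> / 2 + measure \<mu> (Domain H)))" .
    then have "\<theta> * measure \<mu> (- (Domain F \<union> Domain H)) \<le> \<theta> * (\<epsilon> / 2 + measure \<mu> (Domain H))"
      using assms by (subst (asm) ennreal_le_iff) auto
    then have key: "measure \<mu> (- (Domain F \<union> Domain H)) \<le> \<epsilon> / 2 + measure \<mu> (Domain H)"
      using \<open>0 < \<theta>\<close> by simp
    \<comment> \<open>The new tiles are exactly what the uncovered set loses, so \<open>key\<close>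
      says that twice the remainder is at most \<open>\<epsilon> / 2\<close> plus the old uncovered
      mass.\<close>
    have "measure \<mu> (- Domain F) = measure \<mu> (- (Domain F \<union> Domain H)) + measure \<mu> (Domain H)"
    proof -
      have "- Domain F = - (Domain F \<union> Domain H) \<union> Domain H" using H(4) by auto
      then have "measure \<mu> (- Domain F) = measure \<mu> (- (Domain F \<union> Domain H) \<union> Domain H)" by simp
      also have "\<dots> = measure \<mu> (- (Domain F \<union> Domain H)) + measure \<mu> (Domain H)"
        by (rule finite_measure_Union) (use borel_comp[OF UB] H(2) in \<open>auto simp: sets_\<mu> simp del: Compl_Un\<close>)
      finally show ?thesis .
    qed
    then have "measure \<mu> (- (Domain F \<union> Domain H)) \<le> (a + \<epsilon> / 2) / 2" using key a by simp
    moreover have "\<theta> * \<epsilon> / 4 + \<theta> * measure \<mu> (Domain H) \<le> 2 * \<theta>"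
    proof -
      have "\<theta> * \<epsilon> \<le> \<theta>" "\<theta> * measure \<mu> (Domain H) \<le> \<theta>" using assms by (simp_all add: mult_left_le)
      then show ?thesis using \<open>0 < \<theta>\<close> by linarith
    qed
    then have "outflow \<mu> (Domain F \<union> Domain H) \<le> ennreal (2 * \<theta>)"
      using out' ennreal_leI order_trans by blast
    ultimately show "outflow \<mu> (Domain (F \<union> H)) \<le> ennreal (2 * \<theta>) \<and> measure \<mu> (- Domain (F \<union> H)) \<le> (a + \<epsilon> / 2) / 2"
      unfolding dom by blast
  qed
qed

text \<open>Induction with \<open>\<delta>\<close> arbitrary: the last threshold is set by
  \<open>\<delta>\<close>, and the earlier stages are then asked for an outflow of at most
  \<open>\<theta> * \<epsilon> / 4\<close>. Starting from uncovered mass at most 1, each halving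
  leaves the fixed point \<open>\<epsilon> / 2\<close> plus a power of one half.\<close>

lemma packing_iterate:
  assumes am: "unif_borel_amenable G" and \<epsilon>: "0 < \<epsilon>" "\<epsilon> \<le> 1" and "0 < \<delta>"
  shows "\<exists>R F. good_packing \<epsilon> R F \<and> (\<forall>\<mu>. prob_space \<mu> \<and> sets \<mu> = sets borel \<and> invariant_measure G \<mu> \<longrightarrow>
    outflow \<mu> (Domain F) \<le> ennreal \<delta> \<and> measure \<mu> (- Domain F) \<le> (1/2) ^ k + \<epsilon> / 2)"
  using \<open>0 < \<delta>\<close>
proof (induction k arbitrary: \<delta>)
  case 0
  have "good_packing \<epsilon> 0 {}" by (simp add: good_packing_def equiv_def refl_on_def sym_def trans_def)
  moreover have "outflow \<mu> (Domain {}) \<le> ennreal \<delta> \<and> measure \<mu> (- Domain {}) \<le> (1/2) ^ 0 + \<epsilon> / 2" if "prob_space \<mu>" for \<mu>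
  proof -
    interpret prob_space \<mu> by fact
    have "measure \<mu> UNIV \<le> 1" by (rule prob_le_1)
    then have "measure \<mu> UNIV \<le> 1 + \<epsilon> / 2" using \<epsilon> by linarith
    then show ?thesis by (simp add: outflow_def)
  qed
  ultimately show ?case by blast
next
  case (Suc k)
  \<comment> \<open>At most half of \<open>\<delta>\<close>, as a stage ends with outflow up to
    \<open>2 * \<theta>\<close>; the minimum with \<open>\<epsilon>\<close> makes the new tiles
    \<open>\<epsilon>\<close>-good.\<close>
  define \<theta> where "\<theta> = min \<delta> \<epsilon> / 2"
  have \<theta>: "0 < \<theta>" "\<theta> \<le> \<epsilon>" "2 * \<theta> \<le> \<delta>" using Suc.prems \<epsilon> by (auto simp: \<theta>_def)
  then have "0 < \<theta> * \<epsilon> / 4" using \<epsilon> by simp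
  from Suc.IH[OF this] obtain R F where F: "good_packing \<epsilon> R F" "\<And>\<mu>. prob_space \<mu> \<and> sets \<mu> = sets borel \<and> invariant_measure G \<mu> \<Longrightarrow>
    outflow \<mu> (Domain F) \<le> ennreal (\<theta> * \<epsilon> / 4) \<and> measure \<mu> (- Domain F) \<le> (1/2) ^ k + \<epsilon> / 2" by blast
  obtain R' F' where F': "good_packing \<epsilon> R' F'"
    "\<And>\<mu> a. prob_space \<mu> \<Longrightarrow> sets \<mu> = sets borel \<Longrightarrow> invariant_measure G \<mu> \<Longrightarrow>
      outflow \<mu> (Domain F) \<le> ennreal (\<theta> * \<epsilon> / 4) \<Longrightarrow> measure \<mu> (- Domain F) \<le> a \<Longrightarrow>
      outflow \<mu> (Domain F') \<le> ennreal (2 * \<theta>) \<and> measure \<mu> (- Domain F') \<le> (a + \<epsilon> / 2) / 2"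
    using packing_step[OF am \<epsilon> \<theta>(1,2) F(1)] by metis
  have "outflow \<mu> (Domain F') \<le> ennreal \<delta> \<and> measure \<mu> (- Domain F') \<le> (1/2) ^ Suc k + \<epsilon> / 2"
    if \<mu>: "prob_space \<mu> \<and> sets \<mu> = sets borel \<and> invariant_measure G \<mu>" for \<mu>
  proof -
    have "outflow \<mu> (Domain F') \<le> ennreal (2 * \<theta>) \<and> measure \<mu> (- Domain F') \<le> ((1/2) ^ k + \<epsilon> / 2 + \<epsilon> / 2) / 2"
      using \<mu> F(2)[OF \<mu>] by (intro F'(2)) auto
    moreover have "((1/2) ^ k + \<epsilon> / 2 + \<epsilon> / 2) / 2 = (1/2) ^ Suc k + \<epsilon> / 2" by simp
    ultimately show ?thesis using ennreal_leI[OF \<theta>(3)] order_trans by metis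
  qed
  then show ?case using F'(1) by blast
qed

lemma good_packing_folner:
  assumes "good_packing \<epsilon> R F" shows "folner_packing G \<epsilon> F"
proof -
  have F: "F \<in> sets borel" "Domain F \<in> sets borel" "equiv (Domain F) F"
    "\<And>y. y \<in> Domain F \<Longrightarrow> good \<epsilon> R (F `` {y})" using assms by (auto simp: good_packing_def)
  have FR: "(x, y) \<in> ball_rel R" if "(x, y) \<in> F" for x y
  proof -
    have x: "x \<in> Domain F" using that by blast
    then show ?thesis using F(4)[OF x] equiv_class_self[OF F(3) x] that by (auto simp: good_def)
  qed
  have "gdist G x y \<le> R" if xy: "(x, y) \<in> F" for x y
  proof -
    obtain m where "m \<le> R" "(x, y) \<in> G ^^ m" using FR[OF xy] by (auto simp: ball_rel_def)
    then show ?thesis unfolding gdist_def by (meson Least_le order_trans)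
  qed
  moreover have "F \<subseteq> comp_rel G" using FR ball_rel_comp_rel by auto
  ultimately show ?thesis using F good_folner unfolding folner_packing_def borel_packing_def by blast
qed

end

theorem theorem4:
  fixes G :: "('a::polish_space \<times> 'a) set"
  assumes "borel_graph G" and "unif_borel_amenable G" and "folner_graph G"
  shows "\<forall>\<epsilon>::real. \<epsilon> > 0 \<longrightarrow> (\<exists>F. folner_packing G \<epsilon> F \<and>
           (\<forall>\<mu> :: 'a measure. prob_space \<mu> \<and> sets \<mu> = sets borel \<and> invariant_measure G \<mu>
               \<longrightarrow> measure \<mu> (UNIV - Domain F) < \<epsilon>))"
proof (intro allI impI)
  fix \<epsilon> :: real assume "\<epsilon> > 0"
  \<comment> \<open>\<open>packing_step\<close> uses the bound 1 to absorb
    \<open>\<theta> * \<epsilon>\<close> into \<open>\<theta>\<close>; tiles good for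
    \<open>e\<close> are good for \<open>\<epsilon>\<close> as well.\<close>
  define e where "e = min \<epsilon> 1"
  have e: "0 < e" "e \<le> 1" "e \<le> \<epsilon>" using \<open>\<epsilon> > 0\<close> by (auto simp: e_def)
  have bd: "bounded_degree G" using assms(2) by (simp add: unif_borel_amenable_def)
  obtain \<gamma> :: "nat \<Rightarrow> 'a \<Rightarrow> 'a" where \<gamma>:
    "\<And>k. \<gamma> k \<in> borel_measurable borel" "\<And>k. inv (\<gamma> k) \<in> borel_measurable borel" "\<And>k. bij (\<gamma> k)"
    "\<And>x y. (x, y) \<in> comp_rel G \<longleftrightarrow> (\<exists>k. \<gamma> k x = y)"
    using feldman_moore[OF assms(1) bd] by metis
  interpret borel_orbits G \<gamma>
    by standard (use assms(1) bd \<gamma> in \<open>auto simp: borel_graph_def bounded_degree_def\<close>)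
  obtain k where k: "(1/2 :: real) ^ k < e / 2"
    using real_arch_pow_inv[of "e / 2" "1 / 2"] e(1) by auto
  obtain R F where F: "good_packing e R F" "\<And>\<mu>. prob_space \<mu> \<and> sets \<mu> = sets borel \<and> invariant_measure G \<mu> \<Longrightarrow>
    measure \<mu> (- Domain F) \<le> (1/2) ^ k + e / 2"
    using packing_iterate[OF assms(2) e(1,2) zero_less_one, of k] by blast
  have "good_packing \<epsilon> R F"
    using F(1) good_mono[OF _ e(3) order_refl] by (auto simp: good_packing_def)
  then have "folner_packing G \<epsilon> F" by (rule good_packing_folner)
  moreover have "measure \<mu> (UNIV - Domain F) < \<epsilon>"
    if "prob_space \<mu> \<and> sets \<mu> = sets borel \<and> invariant_measure G \<mu>" for \<mu>
    using F(2)[OF that] k e by (simp add: Compl_eq_Diff_UNIV[symmetric])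
  ultimately show "\<exists>F. folner_packing G \<epsilon> F \<and>
           (\<forall>\<mu> :: 'a measure. prob_space \<mu> \<and> sets \<mu> = sets borel \<and> invariant_measure G \<mu>
               \<longrightarrow> measure \<mu> (UNIV - Domain F) < \<epsilon>)" by blast
qed

end
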